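(* Let $G$ be a finite permutation group on a set $\Omega$ and let $A$ be an abelian regular subgroup of $G$ which is a maximal subgroup of $G$ and satisfies $N_G(A)=A$. Fix a point $1\in\Omega$, let $G_1$ be its stabilizer, for $s\in G$ let $G_s=s^{-1}G_1s$ denote the stabilizer of the point $1^s$, and let $N=\bigcap_{g\in G}A^g$ be the core of $A$ in $G$. Then there exist a prime $p$ and subgroups $Q\neq 1$ and $S\neq 1$ of $G$ such that: (1) $A/N$ is cyclic of order coprime to $p$; (2) $G_1$ is an elementary abelian $p$-group; (3) $G/N\cong (G_1N/N)\rtimes(A/N)$, and $G/N$ acts faithfully as an affine primitive group on the right cosets of $A$ in $G$; (4) $N=Z(G)=Q\times C_S(G_1)$; (5) $G=(G_1\times Q)\rtimes S$; (6) $A=Q\times S$; (7) $G_1\times Q$ is the unique Sylow $p$-subgroup of $G$; (8) $N_G(G_1)=C_G(G_1)=G_1\times N$; (9) for all $s,s'\in G\setminus N_G(G_1)$ we have $G_1G_s=G_1G_{s'}$.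
   Context: All groups are finite. A subgroup $A$ of a permutation group $G$ on $\Omega$ is regular if it acts transitively on $\Omega$ with trivial point-stabilizers. $Z(G)$ is the center, $C_X(Y)$ the centralizer and $N_X(Y)$ the normalizer of $Y$ in $X$. *)

theory Defs
  imports "HOL-Algebra.Algebra"
begin

text \<open>Permutation group on \<Omega> with the paper's right-action convention:
  a point x is moved by g to x^g = g x, and the product g h means "first g, then h",
  i.e. (g h) x = h (g x).\<close>
definition rperm_group :: "'a set \<Rightarrow> ('a \<Rightarrow> 'a) set \<Rightarrow> ('a \<Rightarrow> 'a) monoid" where
  "rperm_group \<Omega> H = \<lparr>carrier = H, monoid.mult = (\<lambda>g h. compose \<Omega> h g), one = (\<lambda>x\<in>\<Omega>. x)\<rparr>"

definition maximal_subgroup :: "('g, 'b) monoid_scheme \<Rightarrow> 'g set \<Rightarrow> bool" where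
  "maximal_subgroup G M \<longleftrightarrow> subgroup M G \<and> M \<noteq> carrier G \<and>
     (\<forall>K. subgroup K G \<and> M \<subseteq> K \<longrightarrow> K = M \<or> K = carrier G)"

definition core :: "('g, 'b) monoid_scheme \<Rightarrow> 'g set \<Rightarrow> 'g set" where
  "core G A = (\<Inter>g\<in>carrier G. (inv\<^bsub>G\<^esub> g <#\<^bsub>G\<^esub> A) #>\<^bsub>G\<^esub> g)"

definition center :: "('g, 'b) monoid_scheme \<Rightarrow> 'g set" where
  "center G = {z \<in> carrier G. \<forall>g\<in>carrier G. z \<otimes>\<^bsub>G\<^esub> g = g \<otimes>\<^bsub>G\<^esub> z}"

definition centraliser :: "('g, 'b) monoid_scheme \<Rightarrow> 'g set \<Rightarrow> 'g set \<Rightarrow> 'g set" where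
  "centraliser G W U = {x \<in> W. \<forall>y\<in>U. x \<otimes>\<^bsub>G\<^esub> y = y \<otimes>\<^bsub>G\<^esub> x}"

definition elementary_abelian_p_subgroup :: "('g, 'b) monoid_scheme \<Rightarrow> nat \<Rightarrow> 'g set \<Rightarrow> bool" where
  "elementary_abelian_p_subgroup G p E \<longleftrightarrow> Factorial_Ring.prime p \<and> subgroup E G \<and>
     (\<forall>x\<in>E. \<forall>y\<in>E. x \<otimes>\<^bsub>G\<^esub> y = y \<otimes>\<^bsub>G\<^esub> x) \<and> (\<forall>x\<in>E. x [^]\<^bsub>G\<^esub> p = \<one>\<^bsub>G\<^esub>)"

definition inner_direct_product :: "('g, 'b) monoid_scheme \<Rightarrow> 'g set \<Rightarrow> 'g set \<Rightarrow> 'g set \<Rightarrow> bool" where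
  "inner_direct_product G H K W \<longleftrightarrow> subgroup H G \<and> subgroup K G \<and>
     (\<forall>h\<in>H. \<forall>k\<in>K. h \<otimes>\<^bsub>G\<^esub> k = k \<otimes>\<^bsub>G\<^esub> h) \<and> H \<inter> K = {\<one>\<^bsub>G\<^esub>} \<and> H <#>\<^bsub>G\<^esub> K = W"

definition inner_semidirect_product :: "('g, 'b) monoid_scheme \<Rightarrow> 'g set \<Rightarrow> 'g set \<Rightarrow> 'g set \<Rightarrow> bool" where
  "inner_semidirect_product G H K W \<longleftrightarrow> subgroup H G \<and> subgroup K G \<and>
     H \<inter> K = {\<one>\<^bsub>G\<^esub>} \<and> H <#>\<^bsub>G\<^esub> K = W \<and>
     (\<forall>x\<in>W. \<forall>h\<in>H. x \<otimes>\<^bsub>G\<^esub> h \<otimes>\<^bsub>G\<^esub> inv\<^bsub>G\<^esub> x \<in> H)"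

definition sylow_subgroup :: "('g, 'b) monoid_scheme \<Rightarrow> nat \<Rightarrow> 'g set \<Rightarrow> bool" where
  "sylow_subgroup G p P \<longleftrightarrow> subgroup P G \<and> card P = p ^ multiplicity p (order G)"

definition right_action :: "('g, 'b) monoid_scheme \<Rightarrow> 'e set \<Rightarrow> ('g \<Rightarrow> 'e \<Rightarrow> 'e) \<Rightarrow> bool" where
  "right_action G E \<phi> \<longleftrightarrow> (\<forall>g\<in>carrier G. \<forall>x\<in>E. \<phi> g x \<in> E) \<and> (\<forall>x\<in>E. \<phi> \<one>\<^bsub>G\<^esub> x = x) \<and>
     (\<forall>g\<in>carrier G. \<forall>h\<in>carrier G. \<forall>x\<in>E. \<phi> (g \<otimes>\<^bsub>G\<^esub> h) x = \<phi> h (\<phi> g x))"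

definition faithful_action :: "('g, 'b) monoid_scheme \<Rightarrow> 'e set \<Rightarrow> ('g \<Rightarrow> 'e \<Rightarrow> 'e) \<Rightarrow> bool" where
  "faithful_action G E \<phi> \<longleftrightarrow> right_action G E \<phi> \<and>
     (\<forall>g\<in>carrier G. (\<forall>x\<in>E. \<phi> g x = x) \<longrightarrow> g = \<one>\<^bsub>G\<^esub>)"

definition primitive_action :: "('g, 'b) monoid_scheme \<Rightarrow> 'e set \<Rightarrow> ('g \<Rightarrow> 'e \<Rightarrow> 'e) \<Rightarrow> bool" where
  "primitive_action G E \<phi> \<longleftrightarrow> right_action G E \<phi> \<and>
     (\<forall>x\<in>E. \<forall>y\<in>E. \<exists>g\<in>carrier G. \<phi> g x = y) \<and>
     (\<forall>B. B \<subseteq> E \<and> B \<noteq> {} \<and> (\<forall>g\<in>carrier G. \<phi> g ` B = B \<or> \<phi> g ` B \<inter> B = {})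
          \<longrightarrow> card B = 1 \<or> B = E)"

text \<open>Affine primitive: primitive with a regular normal elementary abelian subgroup
  (the translation subgroup).\<close>
definition affine_primitive_action :: "('g, 'b) monoid_scheme \<Rightarrow> 'e set \<Rightarrow> ('g \<Rightarrow> 'e \<Rightarrow> 'e) \<Rightarrow> bool" where
  "affine_primitive_action G E \<phi> \<longleftrightarrow> primitive_action G E \<phi> \<and>
     (\<exists>V q. elementary_abelian_p_subgroup G q V \<and> V \<lhd> G \<and>
        (\<forall>x\<in>E. \<forall>y\<in>E. \<exists>!v. v \<in> V \<and> \<phi> v x = y))"

end

theory Submission
  imports Defs
begin

text \<open>
  Two distinct conjugates of $A$ generate $G$, and both centralize their intersection. Hence
  $A \<inter> A^g = Z(G) = N$ for $g \<notin> A$, so that $A/N$ is a malnormal abelian subgroup of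
  $G/N$. For abelian malnormal subgroups the transfer is a retraction, and its kernel is a normal
  complement $V$ (Frobenius' theorem without characters). Every element of $A/N$ other than $1$ acts
  on $V$ without fixed points; an invariant Sylow subgroup and the maximality of $A$ show that $V$
  is an elementary abelian $p$-group on which the abelian group $A/N$ acts faithfully and
  irreducibly, hence cyclically.

  The point stabilizer $G_1$ is a complement of $A$, thus $|G_1| = |V|$ is prime to $|A/N|$, and
  therefore $G_1$ is mapped isomorphically onto $V$ and $G_1 \<times> N$ is an abelian normal
  subgroup. The remaining claims follow from the surjectivity of
  $x \<mapsto> x^{-1} x^a$ on $G_1$ modulo $N$ for $a \<in> A \<setminus> N$, and $p$ divides $|N|$
  because otherwise $G_1$ would be characteristic in $G_1 \<times> N$.
\<close>

section \<open>Conjugation and actions of $p$-groups\<close>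

text \<open>The action on \<Omega> enters only through two facts about G_1: it is a complement of A,
  and it is not normal. The second fact carries the finer claims: it forces Q \<noteq> 1 and keeps
  the elements of A outside N from normalizing G_1.

  Commutativity of A pays twice. The transfer takes values in A/N itself instead of a proper
  quotient of it. Also, a Sylow subgroup of V invariant under a single nontrivial element of A/N is
  invariant under all of A/N, which makes the nilpotency theorem for Frobenius kernels dispensable.

  Cyclicity is drawn from trace sums inside V, so no field has to be attached to V.

  The obstacle after the quotient has been understood is that G_1 is not invariant under A; only G_1
  \<times> N is. Identities of V therefore hold in G_1 up to a central factor, and the later
  computations serve to cancel this factor. Q and S are the p-part and the p'-part of A; Q lies in N
  because p does not divide |A/N|.\<close>

lemma (in group) mult_inv_cancel_left:
  assumes "x \<in> carrier G" "y \<in> carrier G"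
  shows "x \<otimes> (inv x \<otimes> y) = y" "inv x \<otimes> (x \<otimes> y) = y"
  using assms by (simp_all flip: m_assoc)

lemmas (in group) group_word_simps = m_assoc inv_mult_group mult_inv_cancel_left

definition (in group) conj :: "'a \<Rightarrow> 'a \<Rightarrow> 'a" where
  "conj g x = g \<otimes> x \<otimes> inv g"

context group begin

lemma conj_closed [simp, intro]: "\<lbrakk>g \<in> carrier G; x \<in> carrier G\<rbrakk> \<Longrightarrow> conj g x \<in> carrier G"
  by (simp add: conj_def)

lemma conj_one [simp]: "x \<in> carrier G \<Longrightarrow> conj \<one> x = x" "g \<in> carrier G \<Longrightarrow> conj g \<one> = \<one>"
  by (simp_all add: conj_def)

lemma conj_mult: "\<lbrakk>g \<in> carrier G; x \<in> carrier G; y \<in> carrier G\<rbrakk> \<Longrightarrow> conj g (x \<otimes> y) = conj g x \<otimes> conj g y"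
  by (simp add: conj_def group_word_simps)

lemma conj_inv: "\<lbrakk>g \<in> carrier G; x \<in> carrier G\<rbrakk> \<Longrightarrow> conj g (inv x) = inv (conj g x)"
  by (simp add: conj_def group_word_simps)

lemma conj_conj: "\<lbrakk>g \<in> carrier G; h \<in> carrier G; x \<in> carrier G\<rbrakk> \<Longrightarrow> conj g (conj h x) = conj (g \<otimes> h) x"
  by (simp add: conj_def group_word_simps)

lemma conj_conj_inv [simp]:
  assumes "g \<in> carrier G" "x \<in> carrier G"
  shows "conj g (conj (inv g) x) = x" "conj (inv g) (conj g x) = x"
  using assms by (simp_all add: conj_conj)

lemma conj_pow: "\<lbrakk>g \<in> carrier G; x \<in> carrier G\<rbrakk> \<Longrightarrow> conj g (x [^] (n::nat)) = conj g x [^] n"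
  by (induction n) (simp_all add: conj_mult)

lemma conj_eq_iff: "\<lbrakk>g \<in> carrier G; x \<in> carrier G; y \<in> carrier G\<rbrakk> \<Longrightarrow> conj g x = conj g y \<longleftrightarrow> x = y"
  by (simp add: conj_def)

lemma conj_inj_on: "g \<in> carrier G \<Longrightarrow> U \<subseteq> carrier G \<Longrightarrow> inj_on (conj g) U"
  by (auto simp: inj_on_def conj_eq_iff subset_iff)

lemma conj_eq_self_iff:
  assumes "g \<in> carrier G" "x \<in> carrier G"
  shows "conj g x = x \<longleftrightarrow> g \<otimes> x = x \<otimes> g"
  using assms inv_solve_right[of x "g \<otimes> x" g] by (auto simp: conj_def)

lemma conj_image_subgroup:
  assumes "g \<in> carrier G" "subgroup H G"
  shows "subgroup (conj g ` H) G"
proof -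
  interpret H: subgroup H G by fact
  show ?thesis
  proof (rule subgroupI)
    show "conj g ` H \<subseteq> carrier G" "conj g ` H \<noteq> {}"
      using assms(1) H.subset H.one_closed by blast+
  next
    fix a assume "a \<in> conj g ` H"
    then show "inv a \<in> conj g ` H"
      using assms(1) H.m_inv_closed by (auto simp flip: conj_inv)
  next
    fix a b assume "a \<in> conj g ` H" "b \<in> conj g ` H"
    then show "a \<otimes> b \<in> conj g ` H"
      using assms(1) H.m_closed by (auto simp flip: conj_mult)
  qed
qed

lemma conj_image_conj_image:
  assumes "g \<in> carrier G" "h \<in> carrier G" "U \<subseteq> carrier G"
  shows "conj g ` conj h ` U = conj (g \<otimes> h) ` U"
  using assms by (force simp: image_image conj_conj subset_iff)

lemma conj_one_image: "U \<subseteq> carrier G \<Longrightarrow> conj \<one> ` U = U"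
  using image_cong[of U U "conj \<one>" "\<lambda>x. x"] by (auto simp: subset_iff)

lemma conj_inv_image:
  assumes "g \<in> carrier G" "U \<subseteq> carrier G"
  shows "conj (inv g) ` conj g ` U = U"
  using assms by (simp add: conj_image_conj_image conj_one_image)

lemma conj_set_eq: "g \<in> carrier G \<Longrightarrow> U \<subseteq> carrier G \<Longrightarrow> g <# U #> inv g = conj g ` U"
  by (auto simp: l_coset_def r_coset_def conj_def)

lemma mem_normalizer_iff:
  assumes "U \<subseteq> carrier G"
  shows "g \<in> normalizer G U \<longleftrightarrow> g \<in> carrier G \<and> conj g ` U = U"
  using assms by (auto simp: normalizer_def stabilizer_def conj_set_eq)

lemma conj_image_eq_of_subset:
  assumes "g \<in> carrier G" "U \<subseteq> carrier G" "finite U" "conj g ` U \<subseteq> U"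
  shows "conj g ` U = U"
  using assms conj_inj_on[OF assms(1,2)] by (simp add: card_subset_eq card_image)

end

section \<open>Fixed points of p-groups\<close>

text \<open>\<open>BijGroup\<close> consists of extensional maps, hence the restriction to
  \<open>E\<close> in the conclusion. Bijectivity comes from the inverse group element.\<close>

lemma group_action_restrict:
  fixes G (structure)
  assumes "group G"
    and "\<And>g x. \<lbrakk>g \<in> carrier G; x \<in> E\<rbrakk> \<Longrightarrow> f g x \<in> E"
    and "\<And>x. x \<in> E \<Longrightarrow> f \<one> x = x"
    and "\<And>g h x. \<lbrakk>g \<in> carrier G; h \<in> carrier G; x \<in> E\<rbrakk> \<Longrightarrow> f (g \<otimes> h) x = f g (f h x)"
  shows "group_action G E (\<lambda>g. \<lambda>x\<in>E. f g x)"
proof -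
  interpret group G by fact
  have inv: "f (inv g) (f g x) = x" "f g (f (inv g) x) = x" if "g \<in> carrier G" "x \<in> E" for g x
    using that assms(3) assms(4)[of "inv g" g x] assms(4)[of g "inv g" x] by auto
  have bij: "(\<lambda>x\<in>E. f g x) \<in> Bij E" if "g \<in> carrier G" for g
  proof -
    have "bij_betw (f g) E E"
      by (rule bij_betw_byWitness[where f' = "f (inv g)"]) (use that inv assms(2) in auto)
    then show ?thesis
      by (simp add: Bij_def cong: bij_betw_cong)
  qed
  have "(\<lambda>g. \<lambda>x\<in>E. f g x) \<in> hom G (BijGroup E)"
    using bij assms(2,4) by (auto simp: hom_def BijGroup_def compose_def restrict_def fun_eq_iff)
  then show ?thesis
    by (simp add: group_action_def group_hom_def group_hom_axioms_def assms(1) group_BijGroup)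
qed

text \<open>Orbit lengths divide a power of \<open>p\<close>, so an orbit is a fixed point or has
  length divisible by \<open>p\<close>. Counting moved points instead of fixed ones lets both
  corollaries below read off their fixed point from one divisibility.\<close>

lemma (in group_action) p_group_card_non_fixed:
  assumes p: "Factorial_Ring.prime (p::nat)" and ord: "order G = p ^ k" and fin: "finite E"
  shows "p dvd card {x \<in> E. \<exists>g\<in>carrier G. \<phi> g x \<noteq> x}"
proof -
  define F where "F = {x \<in> E. \<exists>g\<in>carrier G. \<phi> g x \<noteq> x}"
  have "card F = (\<Sum>x\<in>E. if x \<in> F then 1 else 0)"
    using fin by (simp add: F_def sum.If_cases Int_def)
  also have "\<dots> = (\<Sum>orb\<in>orbits G E \<phi>. \<Sum>x\<in>orb. if x \<in> F then 1 else 0)"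
    using disjoint_sum[OF fin] by metis
  finally have eq: "card F = (\<Sum>orb\<in>orbits G E \<phi>. \<Sum>x\<in>orb. if x \<in> F then 1 else 0)" .
  have "p dvd (\<Sum>y\<in>orb. if y \<in> F then 1 else 0)" if in_orbits: "orb \<in> orbits G E \<phi>" for orb
  proof -
    obtain x where x: "x \<in> E" and orb: "orb = orbit G \<phi> x"
      using in_orbits unfolding orbits_def by blast
    have sub: "orb \<subseteq> E"
      using x element_image by (auto simp: orb orbit_def)
    have finorb: "finite orb"
      using sub fin finite_subset by blast
    have "card orb dvd p ^ k"
      using orbit_stabilizer_theorem[OF x] ord by (metis dvd_triv_left orb)
    then obtain j where j: "card orb = p ^ j"
      using p divides_primepow_nat by blast
    show ?thesis
    proof (cases "j = 0")
      case True
      then obtain z where z: "orb = {z}"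
        using j by (auto simp: card_1_singleton_iff)
      have "z \<notin> F"
      proof
        assume "z \<in> F"
        then obtain g where g: "g \<in> carrier G" "\<phi> g z \<noteq> z" "z \<in> E" by (auto simp: F_def)
        have "z = x" using orbit_refl[OF x] orb z by auto
        then have "\<phi> g z \<in> orb" using g by (auto simp: orb orbit_def)
        with z g show False by simp
      qed
      then show ?thesis by (simp add: z)
    next
      case False
      have "y \<in> F" if y: "y \<in> orb" for y
      proof (rule ccontr)
        assume "y \<notin> F"
        have yE: "y \<in> E" using y sub by auto
        then have fixed: "\<phi> g y = y" if "g \<in> carrier G" for g
          using \<open>y \<notin> F\<close> that by (auto simp: F_def)
        have "x \<in> orbit G \<phi> y" using orbit_sym[OF x yE] y orb by simp
        then have "x = y" using fixed by (auto simp: orbit_def)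
        then have "orb \<subseteq> {y}" using fixed by (auto simp: orb orbit_def)
        then have "card orb \<le> 1" using card_mono[of "{y}" orb] by simp
        moreover have "p ^ j > 1" using False prime_gt_1_nat[OF p] one_less_power[of p j] by simp
        ultimately show False using j by simp
      qed
      then have "(\<Sum>y\<in>orb. if y \<in> F then 1 else 0) = card orb" by simp
      then show ?thesis using j False by (simp add: dvd_power)
    qed
  qed
  then show ?thesis unfolding F_def[symmetric] eq by (rule dvd_sum)
qed

lemma (in group_action) p_group_fixed_point:
  assumes "Factorial_Ring.prime (p::nat)" "order G = p ^ k" "finite E" "\<not> p dvd card E"
  obtains x where "x \<in> E" "\<And>g. g \<in> carrier G \<Longrightarrow> \<phi> g x = x"
proof -
  have "\<exists>x\<in>E. \<forall>g\<in>carrier G. \<phi> g x = x"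
  proof (rule ccontr)
    assume "\<not> ?thesis"
    then have eq: "{x \<in> E. \<exists>g\<in>carrier G. \<phi> g x \<noteq> x} = E" by blast
    show False using p_group_card_non_fixed[OF assms(1-3)] assms(4) unfolding eq by simp
  qed
  then obtain x where x: "x \<in> E" "\<forall>g\<in>carrier G. \<phi> g x = x" ..
  show ?thesis by (rule that[OF x(1)]) (use x(2) in simp)
qed

text \<open>Were \<open>y\<close> the only fixed point, \<open>p\<close> would divide both
  \<open>card E\<close> and \<open>card E - 1\<close>.\<close>

lemma (in group_action) p_group_second_fixed_point:
  assumes p: "Factorial_Ring.prime (p::nat)" "order G = p ^ k" "finite E" "p dvd card E"
    and y: "y \<in> E" "\<And>g. g \<in> carrier G \<Longrightarrow> \<phi> g y = y"
  obtains x where "x \<in> E" "x \<noteq> y" "\<And>g. g \<in> carrier G \<Longrightarrow> \<phi> g x = x"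
proof -
  have "\<exists>x\<in>E. x \<noteq> y \<and> (\<forall>g\<in>carrier G. \<phi> g x = x)"
  proof (rule ccontr)
    assume "\<not> ?thesis"
    then have eq: "{x \<in> E. \<exists>g\<in>carrier G. \<phi> g x \<noteq> x} = E - {y}" using y by auto
    have "card E = Suc (card (E - {y}))" using p(3) y(1) by (rule card.remove)
    moreover have "p dvd card (E - {y})"
      using p_group_card_non_fixed[OF p(1-3)] unfolding eq .
    ultimately have "p dvd Suc (card (E - {y})) - card (E - {y})"
      using p(4) by (metis dvd_diff_nat)
    then show False using prime_gt_1_nat[OF p(1)] by simp
  qed
  then obtain x where x: "x \<in> E" "x \<noteq> y" "\<forall>g\<in>carrier G. \<phi> g x = x" by fast
  show ?thesis by (rule that[OF x(1,2)]) (use x(3) in simp)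
qed

section \<open>Sylow conjugacy and Cauchy's theorem\<close>

text \<open>\<open>Q\<close> acts on the right cosets of \<open>P\<close>, whose number
  \<open>m\<close> is prime to \<open>p\<close>. A fixed coset \<open>P #> g\<close> means that
  conjugation by \<open>g\<close> carries \<open>Q\<close> into \<open>P\<close>, and the orders
  agree.\<close>

theorem (in group) sylow_conjugate:
  assumes p: "Factorial_Ring.prime (p::nat)" and fin: "finite (carrier G)"
    and ord: "order G = p ^ k * m" "\<not> p dvd m"
    and P: "subgroup P G" "card P = p ^ k" and Q: "subgroup Q G" "card Q = p ^ k"
  obtains g where "g \<in> carrier G" "conj g ` Q = P"
proof -
  interpret P: subgroup P G by fact
  interpret Q: subgroup Q G by fact
  let ?Q = "G\<lparr>carrier := Q\<rparr>"
  \<comment> \<open>Multiplying by the inverse turns right multiplication into a left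
    action.\<close>
  have "group_action ?Q (rcosets P) (\<lambda>g. \<lambda>U\<in>rcosets P. U #> inv g)"
  proof (rule group_action_restrict)
    show "group ?Q" by (rule subgroup_imp_group) fact
  next
    fix g U assume "g \<in> carrier ?Q" "U \<in> rcosets P"
    then show "U #> inv g \<in> rcosets P"
      by (auto simp: RCOSETS_def coset_mult_assoc P.subset)
  next
    fix U assume "U \<in> rcosets P"
    then show "U #> inv \<one>\<^bsub>?Q\<^esub> = U"
      using P.rcosets_carrier[OF group_axioms] by simp
  next
    fix g h U assume "g \<in> carrier ?Q" "h \<in> carrier ?Q" "U \<in> rcosets P"
    then show "U #> inv (g \<otimes>\<^bsub>?Q\<^esub> h) = U #> inv h #> inv g"
      using P.rcosets_carrier[OF group_axioms] by (simp add: coset_mult_assoc inv_mult_group)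
  qed
  then interpret A: group_action ?Q "rcosets P" "\<lambda>g. \<lambda>U\<in>rcosets P. U #> inv g" .
  have "card (rcosets P) * p ^ k = p ^ k * m"
    using lagrange[OF P(1)] P(2) ord(1) by simp
  then have "card (rcosets P) = m" using prime_gt_0_nat[OF p] by simp
  then obtain U where U: "U \<in> rcosets P" "\<And>q. q \<in> Q \<Longrightarrow> U #> inv q = U"
    using A.p_group_fixed_point[OF p, of k] ord(2) Q(2) rcosets_subset_PowG[OF P(1)] fin
    by (auto simp: order_def finite_subset)
  then obtain g where g: "g \<in> carrier G" "U = P #> g" by (auto simp: RCOSETS_def)
  have "conj g q \<in> P" if q: "q \<in> Q" for q
  proof -
    have "P #> (g \<otimes> q) = P #> g"
      using U(2)[of "inv q"] g q by (simp add: coset_mult_assoc P.subset)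
    then have "g \<otimes> q \<in> P #> g" using g q P(1) rcos_self by fastforce
    then show ?thesis
      using g q P.rcos_module_imp[OF group_axioms g(1)] by (simp add: conj_def)
  qed
  moreover have "card (conj g ` Q) = card P"
    using P(2) Q(2) conj_inj_on[OF g(1) Q.subset] by (simp add: card_image)
  moreover have "finite P" using P.subset fin finite_subset by blast
  ultimately have "conj g ` Q = P" by (intro card_subset_eq) auto
  with g(1) that show ?thesis by blast
qed

text \<open>The gain over \<open>sylow_conjugate\<close> is a conjugating element inside
  \<open>V\<close>; for a Frobenius kernel \<open>V\<close> it can then be written as
  \<open>inv y \<otimes> conj b y\<close>.\<close>

lemma (in group) subgroup_sylow_conjugate:
  assumes p: "Factorial_Ring.prime (p::nat)" and V: "subgroup V G" "finite V"
    and card: "card V = p ^ k * m" "\<not> p dvd m"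
    and P: "subgroup P G" "card P = p ^ k" "P \<subseteq> V"
    and Q: "subgroup Q G" "card Q = p ^ k" "Q \<subseteq> V"
  obtains g where "g \<in> V" "conj g ` Q = P"
proof -
  interpret V: group "G\<lparr>carrier := V\<rparr>" using V(1) by (rule subgroup_imp_group)
  obtain g where "g \<in> V" "V.conj g ` Q = P"
    using V.sylow_conjugate[OF p, of k m P Q] V card P Q
    by (auto simp: order_def subgroup_incl)
  moreover have "V.conj g x = conj g x" for x
    using \<open>g \<in> V\<close> V(1) by (simp add: V.conj_def conj_def)
  ultimately show ?thesis using that by simp
qed

text \<open>\<open>sylow_thm\<close> accepts any power of \<open>p\<close> dividing the order, so
  the exponent 1 already suffices.\<close>

lemma (in group) subgroup_of_prime_order:
  assumes p: "Factorial_Ring.prime (p::nat)" and H: "subgroup H G" "finite H" "p dvd card H"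
  obtains C where "subgroup C G" "C \<subseteq> H" "card C = p"
proof -
  interpret H: group "G\<lparr>carrier := H\<rparr>" using H(1) by (rule subgroup_imp_group)
  obtain m where "card H = p ^ 1 * m" using H(3) by auto
  then obtain C where C: "subgroup C (G\<lparr>carrier := H\<rparr>)" "card C = p"
    using sylow_thm[OF p H.group_axioms, of 1 m] H(2) by (auto simp: order_def)
  then show thesis
    using that incl_subgroup[OF H(1) C(1)] subgroup.subset[OF C(1)] by simp
qed

lemma (in group) subgroup_cauchy:
  assumes p: "Factorial_Ring.prime (p::nat)" and H: "subgroup H G" "finite H" "p dvd card H"
  obtains x where "x \<in> H" "x \<noteq> \<one>" "x [^] p = \<one>"
proof -
  obtain C where C: "subgroup C G" "C \<subseteq> H" "card C = p"
    using subgroup_of_prime_order[OF assms] .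
  have "C \<noteq> {\<one>}" using C(3) prime_gt_1_nat[OF p] by auto
  then obtain x where x: "x \<in> C" "x \<noteq> \<one>" using subgroup.one_closed[OF C(1)] by auto
  interpret C: group "G\<lparr>carrier := C\<rparr>" using C(1) by (rule subgroup_imp_group)
  have "x [^]\<^bsub>G\<lparr>carrier := C\<rparr>\<^esub> p = \<one>"
    using C.pow_order_eq_1[of x] x(1) C(3) by (simp add: order_def)
  then have "x [^] p = \<one>" by (simp flip: nat_pow_consistent)
  with x C(2) that show thesis by blast
qed

lemma (in group) conj_action:
  assumes "subgroup H G" "V \<subseteq> carrier G" "\<And>h v. h \<in> H \<Longrightarrow> v \<in> V \<Longrightarrow> conj h v \<in> V"
  shows "group_action (G\<lparr>carrier := H\<rparr>) V (\<lambda>g. \<lambda>x\<in>V. conj g x)"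
proof (rule group_action_restrict)
  show "group (G\<lparr>carrier := H\<rparr>)" using assms(1) by (rule subgroup_imp_group)
qed (use assms subgroup.mem_carrier[OF assms(1)] in \<open>auto simp: conj_conj subset_iff\<close>)

lemma (in group) pow_eq_one_coprime:
  assumes x: "x \<in> carrier G" and "x [^] (a::nat) = \<one>" "x [^] (b::nat) = \<one>" "coprime a b"
  shows "x = \<one>"
proof -
  have "ord x dvd a" "ord x dvd b" using assms by (simp_all add: pow_eq_id)
  then have "ord x = 1" using assms(4) coprime_common_divisor_nat by blast
  then show ?thesis using ord_eq_1[OF x] by simp
qed

section \<open>Products and element orders in abelian groups\<close>

text \<open>Serves to exchange the two summations in the trace argument for cyclicity.\<close>

lemma (in comm_monoid) finprod_swap:
  assumes "finite I" "finite J" "\<And>i j. i \<in> I \<Longrightarrow> j \<in> J \<Longrightarrow> f i j \<in> carrier G"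
  shows "(\<Otimes>i\<in>I. \<Otimes>j\<in>J. f i j) = (\<Otimes>j\<in>J. \<Otimes>i\<in>I. f i j)"
  using assms(1,3)
proof (induction I rule: finite_induct)
  case empty
  then show ?case by simp
next
  case (insert a I)
  have "(\<Otimes>i\<in>insert a I. \<Otimes>j\<in>J. f i j) = (\<Otimes>j\<in>J. f a j) \<otimes> (\<Otimes>j\<in>J. \<Otimes>i\<in>I. f i j)"
    using insert by (subst finprod_insert) (auto intro!: finprod_closed)
  also have "\<dots> = (\<Otimes>j\<in>J. f a j \<otimes> (\<Otimes>i\<in>I. f i j))"
    using insert by (subst finprod_multf) (auto intro!: finprod_closed)
  also have "\<dots> = (\<Otimes>j\<in>J. \<Otimes>i\<in>insert a I. f i j)"
    using insert by (intro finprod_cong') (auto intro!: finprod_closed)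
  finally show ?case .
qed

lemma finprod_hom:
  assumes "comm_monoid G" "comm_monoid H" "h \<in> hom G H" "h \<one>\<^bsub>G\<^esub> = \<one>\<^bsub>H\<^esub>"
    and "finite I" "\<And>i. i \<in> I \<Longrightarrow> f i \<in> carrier G"
  shows "h (finprod G f I) = finprod H (\<lambda>i. h (f i)) I"
  using assms(5,6)
proof (induction I rule: finite_induct)
  case empty
  then show ?case using assms by (simp add: comm_monoid.finprod_empty)
next
  case (insert a I)
  have "f \<in> insert a I \<rightarrow> carrier G" "(\<lambda>i. h (f i)) \<in> insert a I \<rightarrow> carrier H"
    using insert assms(3) by (auto simp: hom_def)
  then show ?case
    using insert comm_monoid.finprod_insert[OF assms(1), of I a f]
      comm_monoid.finprod_insert[OF assms(2), of I a "\<lambda>i. h (f i)"]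
      hom_mult[OF assms(3)] comm_monoid.finprod_closed[OF assms(1), of f I] by auto
qed

lemma (in comm_group) ord_mult_coprime:
  assumes x: "x \<in> carrier G" and y: "y \<in> carrier G" and cop: "coprime (ord x) (ord y)"
  shows "ord (x \<otimes> y) = ord x * ord y"
proof (rule dvd_antisym)
  show "ord (x \<otimes> y) dvd ord x * ord y"
    using abelian_ord_mul_divides[OF x y] .
next
  \<comment> \<open>Stated for any coprime factorization of \<open>x \<otimes> y\<close>, so that it
    applies to \<open>x\<close> and, after swapping, to \<open>y\<close>. The exponent
    \<open>?n * ord v\<close> removes \<open>v\<close> and leaves a power of
    \<open>u\<close>.\<close>
  have "ord u dvd ord (x \<otimes> y)"
    if u: "u \<in> carrier G" and v: "v \<in> carrier G" and uv: "u \<otimes> v = x \<otimes> y" and c: "coprime (ord u) (ord v)"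
    for u v
  proof -
    let ?n = "ord (x \<otimes> y)"
    have "(u \<otimes> v) [^] (?n * ord v) = \<one>"
      using u v x y by (subst pow_eq_id) (auto simp: uv)
    moreover have "v [^] (?n * ord v) = \<one>"
      using v by (subst pow_eq_id) auto
    ultimately have "u [^] (?n * ord v) = \<one>"
      using u v by (simp add: pow_mult_distrib[OF m_comm])
    then have "ord u dvd ?n * ord v" using u by (simp add: pow_eq_id)
    then show ?thesis using c by (simp add: coprime_dvd_mult_left_iff)
  qed
  from this[of x y] this[of y x] show "ord x * ord y dvd ord (x \<otimes> y)"
    using x y cop by (auto simp: m_comm coprime_commute intro!: divides_mult)
qed

text \<open>If a prime \<open>q\<close> occurs in \<open>ord y\<close> with a higher exponent than
  in \<open>ord x\<close>, exchange the \<open>q\<close>-part of \<open>x\<close> for that of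
  \<open>y\<close>: the two factors have coprime orders, and the order of their product exceeds the
  maximum.\<close>

lemma (in comm_group) max_ord_dvd:
  assumes fin: "finite (carrier G)" and x: "x \<in> carrier G"
    and max: "\<And>y. y \<in> carrier G \<Longrightarrow> ord y \<le> ord x" and y: "y \<in> carrier G"
  shows "ord y dvd ord x"
proof (rule ccontr)
  assume not_dvd: "\<not> ord y dvd ord x"
  have pos: "ord z > 0" if "z \<in> carrier G" for z using ord_ge_1[OF fin that] by simp
  have "\<exists>q. Factorial_Ring.prime q \<and> multiplicity q (ord x) < multiplicity q (ord y)"
    using not_dvd multiplicity_le_imp_dvd[of "ord y" "ord x"] pos[OF y] pos[OF x]
    by (metis not_less gr_implies_not0)
  then obtain q where q: "Factorial_Ring.prime q" and lt: "multiplicity q (ord x) < multiplicity q (ord y)"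
    by blast
  let ?e = "multiplicity q (ord y)" and ?f = "multiplicity q (ord x)"
  obtain c where c: "ord y = q ^ ?e * c" using multiplicity_dvd[of q "ord y"] by (auto elim: dvdE)
  obtain d where d: "ord x = q ^ ?f * d" using multiplicity_dvd[of q "ord x"] by (auto elim: dvdE)
  have "\<not> q dvd d"
  proof
    assume "q dvd d"
    then have "q ^ Suc ?f dvd ord x" by (subst d) (simp add: mult.commute mult_dvd_mono)
    then have "Suc ?f \<le> ?f"
      using q pos[OF x] by (intro multiplicity_geI) (auto simp: prime_nat_iff)
    then show False by simp
  qed
  have cd: "c > 0" "d > 0" using c d pos[OF x] pos[OF y] by (auto intro: gr0I)
  let ?x = "x [^] (q ^ ?f)" and ?y = "y [^] c"
  have ox: "ord ?x = d"
    using ord_pow[OF x, of "q ^ ?f"] d q by (metis dvd_triv_left nonzero_mult_div_cancel_left not_prime_0 power_not_zero)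
  have oy: "ord ?y = q ^ ?e"
    using ord_pow[OF y, of c] c cd(1) by (metis dvd_triv_right nonzero_mult_div_cancel_right not_gr_zero)
  have "coprime d (q ^ ?e)"
    using prime_imp_coprime[OF q \<open>\<not> q dvd d\<close>] by (simp add: coprime_commute)
  then have "ord (?x \<otimes> ?y) = d * q ^ ?e"
    using ord_mult_coprime[of ?x ?y] x y ox oy by simp
  also have "\<dots> > ord x"
    using lt cd(2) prime_gt_1_nat[OF q] by (subst d) simp
  finally show False using max[of "?x \<otimes> ?y"] x y by simp
qed

lemma (in group) card_set_mult_disjoint:
  assumes "subgroup H G" "subgroup L G" "H \<inter> L = {\<one>}"
  shows "card (H <#> L) = card H * card L"
proof -
  have "inj_on (\<lambda>(x, y). x \<otimes> y) (H \<times> L)"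
  proof (rule inj_onI, clarify)
    fix x y x' y' assume *: "x \<in> H" "y \<in> L" "x' \<in> H" "y' \<in> L" "x \<otimes> y = x' \<otimes> y'"
    show "x = x' \<and> y = y'"
      using group_disjoint_sum.cancel[of G H L] assms * group_axioms
      by (simp add: group_disjoint_sum_def)
  qed
  moreover have "(\<lambda>(x, y). x \<otimes> y) ` (H \<times> L) = H <#> L" by (auto simp: set_mult_def)
  ultimately show ?thesis by (metis card_image card_cartesian_product)
qed

section \<open>Normal complements of malnormal abelian subgroups\<close>

text \<open>For a nontrivial proper \<open>B\<close> this is the setting of a Frobenius group with
  abelian complement.\<close>

locale malnormal_abelian = group +
  fixes B
  assumes fin: "finite (carrier G)"
    and B: "subgroup B G"
    and B_comm: "\<lbrakk>a \<in> B; b \<in> B\<rbrakk> \<Longrightarrow> a \<otimes> b = b \<otimes> a"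
    and malnormal: "\<lbrakk>g \<in> carrier G; g \<notin> B; b \<in> B; conj g b \<in> B\<rbrakk> \<Longrightarrow> b = \<one>"
begin

sublocale B: subgroup B G by (rule B)

sublocale GB: comm_group "G\<lparr>carrier := B\<rparr>"
  using B_comm subgroup_imp_group[OF B] by (intro group.group_comm_groupI) auto

lemma finite_B: "finite B"
  using B.subset fin finite_subset by blast

text \<open>
  Representatives of the left cosets of \<^term>\<open>B\<close> that are permuted by left multiplication
  with elements of \<^term>\<open>B\<close>, apart from the representative of \<^term>\<open>B\<close> itself. With respect to
  such a system all but one factor of the transfer of an element of \<^term>\<open>B\<close> are trivial.
\<close>
lemma equivariant_representatives:
  obtains r where "\<And>g. g \<in> carrier G \<Longrightarrow> r g \<in> carrier G"
    and "\<And>g. g \<in> carrier G \<Longrightarrow> inv (r g) \<otimes> g \<in> B"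
    and "\<And>g b. \<lbrakk>g \<in> carrier G; b \<in> B\<rbrakk> \<Longrightarrow> r (g \<otimes> b) = r g"
    and "r \<one> = \<one>"
    and "\<And>g b. \<lbrakk>g \<in> carrier G; g \<notin> B; b \<in> B\<rbrakk> \<Longrightarrow> r (b \<otimes> g) = b \<otimes> r g"
proof -
  \<comment> \<open>\<open>D g\<close> is the double coset of \<open>g\<close>, and \<open>s\<close>
    picks an element that depends on this double coset only.\<close>
  define D where "D g = {b \<otimes> g \<otimes> c | b c. b \<in> B \<and> c \<in> B}" for g
  define s where "s g = (SOME x. x \<in> D g)" for g
  have D_sub: "D (b \<otimes> g \<otimes> c) \<subseteq> D g" if "g \<in> carrier G" "b \<in> B" "c \<in> B" for b g c
  proof
    fix x assume "x \<in> D (b \<otimes> g \<otimes> c)"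
    then obtain b' c' where bc: "b' \<in> B" "c' \<in> B" "x = b' \<otimes> (b \<otimes> g \<otimes> c) \<otimes> c'"
      by (auto simp: D_def)
    then have "x = (b' \<otimes> b) \<otimes> g \<otimes> (c \<otimes> c')" using that by (simp add: m_assoc)
    then show "x \<in> D g" unfolding D_def using bc that by blast
  qed
  have D_eq: "D (b \<otimes> g \<otimes> c) = D g" if "g \<in> carrier G" "b \<in> B" "c \<in> B" for b g c
  proof (rule equalityI[OF D_sub[OF that]])
    have "inv b \<otimes> (b \<otimes> g \<otimes> c) \<otimes> inv c = g" using that by (simp add: group_word_simps)
    then show "D g \<subseteq> D (b \<otimes> g \<otimes> c)"
      using D_sub[of "b \<otimes> g \<otimes> c" "inv b" "inv c"] that by simp
  qed
  have s_right: "s (g \<otimes> c) = s g" if "g \<in> carrier G" "c \<in> B" for g c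
    using D_eq[of g \<one> c] that by (simp add: s_def)
  have s_left: "s (b \<otimes> g) = s g" if "g \<in> carrier G" "b \<in> B" for b g
    using D_eq[of g b \<one>] that by (simp add: s_def)
  have s_in: "s g \<in> D g" if "g \<in> carrier G" for g
  proof -
    have "\<one> \<otimes> g \<otimes> \<one> \<in> D g" unfolding D_def using B.one_closed by blast
    then show ?thesis unfolding s_def by (rule someI)
  qed
  \<comment> \<open>The candidates for a representative of the left coset of \<open>g\<close>: left
    translates of \<open>s g\<close> by \<open>B\<close> that lie in this coset.\<close>
  define R where "R g x \<longleftrightarrow> (\<exists>b\<in>B. x = b \<otimes> s g) \<and> inv g \<otimes> x \<in> B" for g x
  have R_ex: "\<exists>x. R g x" if g: "g \<in> carrier G" for g
  proof -
    obtain b c where bc: "b \<in> B" "c \<in> B" "s g = b \<otimes> g \<otimes> c" using s_in[OF g] by (auto simp: D_def)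
    then have "inv b \<otimes> s g = g \<otimes> c" using g by (simp add: group_word_simps)
    then have "R g (g \<otimes> c)" unfolding R_def using bc g
      by (metis B.m_inv_closed B.mem_carrier mult_inv_cancel_left(2))
    then show ?thesis ..
  qed
  have R_carrier: "x \<in> carrier G" if "R g x" "g \<in> carrier G" for g x
    using that s_in[of g] by (auto simp: R_def D_def)
  \<comment> \<open>Here malnormality enters: \<open>inv b \<otimes> c\<close>, by which two
    candidates differ, is conjugated into \<open>B\<close> by \<open>inv (s g)\<close>, an element
    outside \<open>B\<close>, and so is trivial.\<close>
  have R_unique: "x = y" if g: "g \<in> carrier G" "g \<notin> B" and R: "R g x" "R g y" for g x y
  proof -
    obtain b c where bc: "b \<in> B" "c \<in> B" "x = b \<otimes> s g" "y = c \<otimes> s g"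
      using R by (auto simp: R_def)
    obtain b' c' where s: "b' \<in> B" "c' \<in> B" "s g = b' \<otimes> g \<otimes> c'"
      using s_in[OF g(1)] by (auto simp: D_def)
    have sG: "s g \<in> carrier G" using s g by simp
    have "s g \<notin> B"
    proof
      assume "s g \<in> B"
      then have "inv b' \<otimes> s g \<otimes> inv c' \<in> B" using s by simp
      then show False using s g by (simp add: group_word_simps)
    qed
    then have inv_s: "inv (s g) \<notin> B" using sG B.m_inv_closed[of "inv (s g)"] by auto
    have "inv (inv g \<otimes> x) \<otimes> (inv g \<otimes> y) \<in> B" using R by (auto simp: R_def)
    moreover have "inv (inv g \<otimes> x) \<otimes> (inv g \<otimes> y) = conj (inv (s g)) (inv b \<otimes> c)"
      using bc sG g by (simp add: conj_def group_word_simps)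
    ultimately have "inv b \<otimes> c = \<one>" using malnormal[of "inv (s g)"] inv_s sG bc by auto
    then have "b = c" using bc by (metis B.mem_carrier inv_closed inv_equality inv_inv)
    then show ?thesis using bc by simp
  qed
  \<comment> \<open>For \<open>g\<close> in \<open>B\<close> every element of \<open>B\<close> is a
    candidate, so the value \<one> is prescribed.\<close>
  define r where "r g = (if g \<in> B then \<one> else SOME x. R g x)" for g
  have R_r: "R g (r g)" if "g \<in> carrier G" "g \<notin> B" for g
    using someI_ex[OF R_ex[OF that(1)]] that(2) by (simp add: r_def)
  have r_eq: "r g = x" if "g \<in> carrier G" "g \<notin> B" "R g x" for g x
    using R_unique[OF that(1,2) R_r[OF that(1,2)] that(3)] .
  have mem_right: "g \<otimes> c \<in> B \<longleftrightarrow> g \<in> B" if "g \<in> carrier G" "c \<in> B" for g c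
    using that B.m_closed[of "g \<otimes> c" "inv c"] by (auto simp: group_word_simps)
  have mem_left: "c \<otimes> g \<in> B \<longleftrightarrow> g \<in> B" if "g \<in> carrier G" "c \<in> B" for g c
    using that B.m_closed[of "inv c" "c \<otimes> g"] by (auto simp: group_word_simps)
  have closed: "r g \<in> carrier G" if "g \<in> carrier G" for g
  proof (cases "g \<in> B")
    case True
    then show ?thesis by (simp add: r_def)
  next
    case False
    then show ?thesis using R_carrier[OF R_r[OF that]] that by blast
  qed
  have mem: "inv (r g) \<otimes> g \<in> B" if "g \<in> carrier G" for g
  proof (cases "g \<in> B")
    case False
    then have "inv (inv g \<otimes> r g) \<in> B" using R_r[OF that] by (auto simp: R_def)
    then show ?thesis using that closed by (simp add: inv_mult_group)
  qed (simp add: r_def)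
  have one: "r \<one> = \<one>" by (simp add: r_def)
  have right: "r (g \<otimes> b) = r g" if "g \<in> carrier G" "b \<in> B" for g b
  proof (cases "g \<in> B")
    case True
    then show ?thesis using that by (simp add: r_def)
  next
    case False
    have *: "\<exists>c\<in>B. r g = c \<otimes> s g" "inv g \<otimes> r g \<in> B"
      using R_r[OF that(1) False] by (simp_all add: R_def)
    have "inv (g \<otimes> b) \<otimes> r g = inv b \<otimes> (inv g \<otimes> r g)"
      using that closed by (simp add: inv_mult_group m_assoc)
    then have "inv (g \<otimes> b) \<otimes> r g \<in> B" using *(2) that(2) by simp
    then have "R (g \<otimes> b) (r g)" unfolding R_def s_right[OF that] using *(1) by blast
    then show ?thesis using r_eq[of "g \<otimes> b" "r g"] mem_right[OF that] False that by simp
  qed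
  have left: "r (b \<otimes> g) = b \<otimes> r g" if g: "g \<in> carrier G" "g \<notin> B" and b: "b \<in> B" for g b
  proof -
    obtain c where c: "c \<in> B" "r g = c \<otimes> s g" and *: "inv g \<otimes> r g \<in> B"
      using R_r[OF g] unfolding R_def by blast
    have "s g \<in> carrier G" using s_in[OF g(1)] g by (auto simp: D_def)
    then have eq: "b \<otimes> r g = (b \<otimes> c) \<otimes> s g" unfolding c(2) using b c(1) by (simp add: m_assoc)
    have inv_eq: "inv (b \<otimes> g) \<otimes> (b \<otimes> r g) = inv g \<otimes> r g"
      using b g closed by (simp add: group_word_simps)
    have "b \<otimes> c \<in> B" using b c(1) by simp
    then have "R (b \<otimes> g) (b \<otimes> r g)"
      unfolding R_def s_left[OF g(1) b] inv_eq using * eq by blast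
    then show ?thesis using r_eq[of "b \<otimes> g" "b \<otimes> r g"] mem_left[OF g(1) b] g b by simp
  qed
  show thesis
    by (rule that[of r]) (simp_all add: closed mem one right left)
qed

lemma transfer_retraction:
  obtains f where "f \<in> hom G (G\<lparr>carrier := B\<rparr>)" "\<And>b. b \<in> B \<Longrightarrow> f b = b"
proof (rule equivariant_representatives)
  fix r
  assume r [simp]: "\<And>g. g \<in> carrier G \<Longrightarrow> r g \<in> carrier G"
    and r_mem: "\<And>g. g \<in> carrier G \<Longrightarrow> inv (r g) \<otimes> g \<in> B"
    and r_right: "\<And>g b. \<lbrakk>g \<in> carrier G; b \<in> B\<rbrakk> \<Longrightarrow> r (g \<otimes> b) = r g"
    and r_one: "r \<one> = \<one>"
    and r_left: "\<And>g b. \<lbrakk>g \<in> carrier G; g \<notin> B; b \<in> B\<rbrakk> \<Longrightarrow> r (b \<otimes> g) = b \<otimes> r g"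
  \<comment> \<open>\<open>T\<close> is the system of representatives, \<open>\<tau> g\<close> is
    what remains in \<open>B\<close> after splitting off the representative of \<open>g\<close>, and
    \<open>f\<close> is the transfer.\<close>
  define T where "T = r ` carrier G"
  define \<tau> where "\<tau> g = inv (r g) \<otimes> g" for g
  define f where "f g = finprod (G\<lparr>carrier := B\<rparr>) (\<lambda>t. \<tau> (g \<otimes> t)) T" for g
  have finT: "finite T" using fin by (simp add: T_def)
  have TG: "t \<in> carrier G" if "t \<in> T" for t using that by (auto simp: T_def)
  have \<tau>B: "\<tau> g \<in> B" if "g \<in> carrier G" for g using r_mem[OF that] by (simp add: \<tau>_def)
  have decomp: "r g \<otimes> \<tau> g = g" if "g \<in> carrier G" for g
    using that by (simp add: \<tau>_def group_word_simps)
  have rr: "r (r g) = r g" if "g \<in> carrier G" for g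
    by (metis that r \<tau>B decomp r_right)
  have rT: "r t = t" if "t \<in> T" for t using that rr by (auto simp: T_def)
  have r_mult: "r (g \<otimes> h) = r (g \<otimes> r h)" if "g \<in> carrier G" "h \<in> carrier G" for g h
  proof -
    have "g \<otimes> h = (g \<otimes> r h) \<otimes> \<tau> h" using that \<tau>B decomp[of h] by (simp add: m_assoc)
    then show ?thesis using r_right[of "g \<otimes> r h" "\<tau> h"] that \<tau>B by simp
  qed
  \<comment> \<open>The cocycle identity behind the multiplicativity of the transfer.\<close>
  have \<tau>_mult: "\<tau> (g \<otimes> h) = \<tau> (g \<otimes> r h) \<otimes> \<tau> h" if "g \<in> carrier G" "h \<in> carrier G" for g h
  proof -
    have "\<tau> (g \<otimes> h) = inv (r (g \<otimes> r h)) \<otimes> (g \<otimes> (r h \<otimes> \<tau> h))"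
      using that by (simp add: \<tau>_def r_mult[symmetric] decomp[unfolded \<tau>_def])
    also have "\<dots> = \<tau> (g \<otimes> r h) \<otimes> \<tau> h"
      using that \<tau>B[of h] by (simp add: \<tau>_def[of "g \<otimes> r h"] m_assoc)
    finally show ?thesis .
  qed
  have perm: "inj_on (\<lambda>t. r (h \<otimes> t)) T" "(\<lambda>t. r (h \<otimes> t)) ` T = T" if h: "h \<in> carrier G" for h
  proof -
    show inj: "inj_on (\<lambda>t. r (h \<otimes> t)) T"
    proof (rule inj_onI)
      fix t u assume tu: "t \<in> T" "u \<in> T" "r (h \<otimes> t) = r (h \<otimes> u)"
      have "r (inv h \<otimes> (h \<otimes> t)) = r (inv h \<otimes> (h \<otimes> u))"
        using tu h TG by (subst (1 2) r_mult) auto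
      then show "t = u" using tu h TG rT by (simp add: mult_inv_cancel_left)
    qed
    have "(\<lambda>t. r (h \<otimes> t)) ` T \<subseteq> T" using h TG by (auto simp: T_def)
    then show "(\<lambda>t. r (h \<otimes> t)) ` T = T" using inj finT by (simp add: endo_inj_surj)
  qed
  show thesis
  proof (rule that[of f])
    show "f \<in> hom G (G\<lparr>carrier := B\<rparr>)"
    proof (rule homI)
      show "f g \<in> carrier (G\<lparr>carrier := B\<rparr>)" if "g \<in> carrier G" for g
        unfolding f_def using that \<tau>B TG by (intro GB.finprod_closed) auto
      fix g h assume g: "g \<in> carrier G" and h: "h \<in> carrier G"
      \<comment> \<open>Left multiplication by \<open>h\<close> permutes the cosets, so the first
        factors of the cocycle identity form the product \<open>f g\<close> in another
        order.\<close>
      have reindex: "finprod (G\<lparr>carrier := B\<rparr>) (\<lambda>t. \<tau> (g \<otimes> r (h \<otimes> t))) T = f g"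
        using GB.finprod_reindex[of "\<lambda>t. \<tau> (g \<otimes> t)" "\<lambda>t. r (h \<otimes> t)" T] perm[OF h] g \<tau>B TG
        by (simp add: f_def)
      have "f (g \<otimes> h) = finprod (G\<lparr>carrier := B\<rparr>) (\<lambda>t. \<tau> (g \<otimes> r (h \<otimes> t)) \<otimes> \<tau> (h \<otimes> t)) T"
        unfolding f_def
      proof (intro GB.finprod_cong')
        fix t assume "t \<in> T"
        then show "\<tau> (g \<otimes> h \<otimes> t) = \<tau> (g \<otimes> r (h \<otimes> t)) \<otimes> \<tau> (h \<otimes> t)"
          using g h TG \<tau>_mult[of g "h \<otimes> t"] by (simp add: m_assoc)
      qed (use g h \<tau>B TG in auto)
      also have "\<dots> = finprod (G\<lparr>carrier := B\<rparr>) (\<lambda>t. \<tau> (g \<otimes> r (h \<otimes> t))) T \<otimes> f h"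
        unfolding f_def
        using GB.finprod_multf[of "\<lambda>t. \<tau> (g \<otimes> r (h \<otimes> t))" T "\<lambda>t. \<tau> (h \<otimes> t)"] g h \<tau>B TG
        by simp
      finally show "f (g \<otimes> h) = f g \<otimes>\<^bsub>G\<lparr>carrier := B\<rparr>\<^esub> f h"
        unfolding reindex by simp
    qed
  next
    fix b assume b: "b \<in> B"
    have one: "\<one> \<in> T" unfolding T_def using imageI[OF one_closed, of r] unfolding r_one .
    have "\<tau> (b \<otimes> t) = \<one>" if t: "t \<in> T - {\<one>}" for t
    proof -
      \<comment> \<open>\<open>r\<close> is constant on \<open>B\<close>, so \<one> is the only
        representative in \<open>B\<close>.\<close>
      have "t \<notin> B"
      proof
        assume "t \<in> B"
        then have "r (\<one> \<otimes> t) = r \<one>" by (intro r_right) simp_all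
        then have "r t = r \<one>" using TG t by simp
        then show False using t rT[of t] r_one by simp
      qed
      then have "r (b \<otimes> t) = b \<otimes> t" using t b TG rT[of t] r_left[of t b] by auto
      then show ?thesis using t b TG by (simp add: \<tau>_def)
    qed
    then have "finprod (G\<lparr>carrier := B\<rparr>) (\<lambda>t. \<tau> (b \<otimes> t)) (T - {\<one>}) = \<one>"
      using GB.finprod_one_eqI[of "T - {\<one>}" "\<lambda>t. \<tau> (b \<otimes> t)"] by simp
    moreover have "finprod (G\<lparr>carrier := B\<rparr>) (\<lambda>t. \<tau> (b \<otimes> t)) (insert \<one> (T - {\<one>}))
        = \<tau> (b \<otimes> \<one>) \<otimes> finprod (G\<lparr>carrier := B\<rparr>) (\<lambda>t. \<tau> (b \<otimes> t)) (T - {\<one>})"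
      using GB.finprod_insert[of "T - {\<one>}" \<one> "\<lambda>t. \<tau> (b \<otimes> t)"] finT b \<tau>B TG by simp
    moreover have "\<tau> b = b" using r_right[of \<one> b] b r_one by (simp add: \<tau>_def)
    ultimately show "f b = b" using b one by (simp add: f_def insert_absorb)
  qed
qed

theorem normal_complement:
  obtains V where "V \<lhd> G" "V \<inter> B = {\<one>}" "\<And>g. g \<in> carrier G \<Longrightarrow> \<exists>v\<in>V. \<exists>b\<in>B. g = v \<otimes> b"
proof (rule transfer_retraction)
  fix f
  assume f: "f \<in> hom G (G\<lparr>carrier := B\<rparr>)" "\<And>b. b \<in> B \<Longrightarrow> f b = b"
  interpret f: group_hom G "G\<lparr>carrier := B\<rparr>" f
    using f(1) by (simp add: group_hom_def group_hom_axioms_def group_axioms GB.group_axioms)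
  let ?V = "kernel G (G\<lparr>carrier := B\<rparr>) f"
  show thesis
  proof (rule that[of ?V])
    show "?V \<lhd> G" by (rule f.normal_kernel)
    show "?V \<inter> B = {\<one>}" using f(2) f.hom_one by (auto simp: kernel_def)
    fix g assume g: "g \<in> carrier G"
    have fg: "f g \<in> B" using f.hom_closed[OF g] by simp
    have "f (g \<otimes> inv (f g)) = f g \<otimes> f (inv (f g))" using g fg by (simp add: f.hom_mult)
    also have "\<dots> = \<one>" using fg by (simp add: f(2))
    finally have "g \<otimes> inv (f g) \<in> ?V" using g fg by (simp add: kernel_def)
    moreover have "g = (g \<otimes> inv (f g)) \<otimes> f g" using g fg by (simp add: group_word_simps)
    ultimately show "\<exists>v\<in>?V. \<exists>b\<in>B. g = v \<otimes> b" using fg by blast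
  qed
qed

end

section \<open>The Frobenius kernel of a maximal malnormal abelian subgroup\<close>

locale maximal_malnormal = malnormal_abelian +
  fixes V
  assumes maximal: "\<lbrakk>subgroup K G; B \<subseteq> K\<rbrakk> \<Longrightarrow> K = B \<or> K = carrier G"
    and B_nontrivial: "B \<noteq> {\<one>}"
    and B_proper: "B \<noteq> carrier G"
    and V: "V \<lhd> G"
    and V_inter_B: "V \<inter> B = {\<one>}"
    and V_mult_B: "g \<in> carrier G \<Longrightarrow> \<exists>v\<in>V. \<exists>b\<in>B. g = v \<otimes> b"
begin

sublocale V: normal V G by (rule V)

lemma conj_V [simp]: "\<lbrakk>g \<in> carrier G; v \<in> V\<rbrakk> \<Longrightarrow> conj g v \<in> V"
  unfolding conj_def by (rule V.inv_op_closed2)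

lemma V_subgroup: "subgroup V G"
  by (rule V.subgroup_axioms)

lemma finite_V: "finite V"
  using V.subset fin finite_subset by blast

lemma V_nontrivial: "V \<noteq> {\<one>}"
proof
  assume "V = {\<one>}"
  then have "carrier G \<subseteq> B" using V_mult_B by auto
  then show False using B_proper B.subset by auto
qed

lemma ex_prime_dvd_card_V: "\<exists>p. Factorial_Ring.prime p \<and> p dvd card V"
proof -
  have "card V \<noteq> 1"
  proof
    assume "card V = 1"
    then obtain x where "V = {x}" by (auto simp: card_1_singleton_iff)
    then show False using V_nontrivial V.one_closed by blast
  qed
  then show ?thesis using prime_factor_nat by blast
qed

text \<open>Commuting is symmetric: if \<open>b\<close> fixes \<open>v\<close>, then
  \<open>v\<close> centralizes \<open>b \<noteq> \<one>\<close>, and malnormality puts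
  \<open>v\<close> into \<open>B\<close>.\<close>

lemma fixed_point_free:
  assumes "b \<in> B" "b \<noteq> \<one>" "v \<in> V" "conj b v = v"
  shows "v = \<one>"
proof -
  have "conj v b = b" using assms by (simp add: conj_eq_self_iff)
  then have "v \<in> B" using malnormal[of v b] assms by auto
  then show ?thesis using V_inter_B assms(3) by auto
qed

lemma card_V_B: "card V * card B = order G"
proof -
  have "V <#> B = carrier G"
    using V_mult_B set_mult_closed[OF V.subset B.subset] unfolding set_mult_def by blast
  then show ?thesis
    using card_set_mult_disjoint[OF V_subgroup B V_inter_B] by (simp add: order_def)
qed

text \<open>Invariance makes the product of \<open>W\<close> and \<open>B\<close> a subgroup
  containing \<open>B\<close>. Maximality leaves two cases; uniqueness of the factorization along
  \<open>V\<close> and \<open>B\<close> turns them into \<open>W\<close> trivial and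
  \<open>W = V\<close>.\<close>

lemma minimal_V:
  assumes W: "subgroup W G" "W \<subseteq> V" and inv: "\<And>b w. b \<in> B \<Longrightarrow> w \<in> W \<Longrightarrow> conj b w \<in> W"
  shows "W = {\<one>} \<or> W = V"
proof -
  interpret W: subgroup W G by (rule W)
  define K where "K = {w \<otimes> b | w b. w \<in> W \<and> b \<in> B}"
  have "subgroup K G"
  proof (rule subgroupI)
    show "K \<subseteq> carrier G" by (auto simp: K_def)
    show "K \<noteq> {}" using W.one_closed B.one_closed unfolding K_def by blast
  next
    fix x assume "x \<in> K"
    then obtain w b where wb: "w \<in> W" "b \<in> B" "x = w \<otimes> b" by (auto simp: K_def)
    then have "inv x = conj (inv b) (inv w) \<otimes> inv b" by (simp add: conj_def group_word_simps)
    moreover have "conj (inv b) (inv w) \<in> W" "inv b \<in> B" using wb inv by auto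
    ultimately show "inv x \<in> K" unfolding K_def by blast
  next
    fix x y assume "x \<in> K" "y \<in> K"
    then obtain w b w' b' where wb: "w \<in> W" "b \<in> B" "x = w \<otimes> b" "w' \<in> W" "b' \<in> B" "y = w' \<otimes> b'"
      by (auto simp: K_def)
    then have "x \<otimes> y = (w \<otimes> conj b w') \<otimes> (b \<otimes> b')" by (simp add: conj_def group_word_simps)
    moreover have "w \<otimes> conj b w' \<in> W" "b \<otimes> b' \<in> B" using wb inv by auto
    ultimately show "x \<otimes> y \<in> K" unfolding K_def by blast
  qed
  moreover have BK: "B \<subseteq> K"
  proof
    fix b assume "b \<in> B"
    then have "b = \<one> \<otimes> b" by simp
    then show "b \<in> K" unfolding K_def using \<open>b \<in> B\<close> W.one_closed by blast
  qed
  ultimately consider "K = B" | "K = carrier G" using maximal by blast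
  then show ?thesis
  proof cases
    case 1
    have "w \<in> B" if "w \<in> W" for w
    proof -
      have "w = w \<otimes> \<one>" using that by simp
      then have "w \<in> K" unfolding K_def using that B.one_closed by blast
      then show ?thesis using 1 by simp
    qed
    then have "W \<subseteq> V \<inter> B" using W(2) by auto
    then show ?thesis using V_inter_B W.one_closed by auto
  next
    case 2
    have "v \<in> W" if v: "v \<in> V" for v
    proof -
      have "v \<in> K" using 2 v by auto
      then obtain w b where wb: "w \<in> W" "b \<in> B" "v = w \<otimes> b" by (auto simp: K_def)
      have wV: "w \<in> V" using wb W(2) by auto
      have "inv w \<otimes> v = b" using wb by (simp add: group_word_simps)
      moreover have "inv w \<otimes> v \<in> V" using v wV by simp
      ultimately have "b = \<one>" using wb V_inter_B by auto
      then show ?thesis using wb by simp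
    qed
    then show ?thesis using W(2) by auto
  qed
qed

section \<open>Invariant Sylow subgroups of the kernel\<close>

text \<open>Equal values say that \<open>b\<close> fixes \<open>z \<otimes> inv y\<close>.\<close>

lemma twist_inj:
  assumes b: "b \<in> B" "b \<noteq> \<one>" and yz: "y \<in> V" "z \<in> V"
    and eq: "inv y \<otimes> conj b y = inv z \<otimes> conj b z"
  shows "y = z"
proof -
  have [simp]: "y \<in> carrier G" "z \<in> carrier G" "b \<in> carrier G" using yz b by auto
  have "z \<otimes> (inv y \<otimes> conj b y) \<otimes> inv (conj b y) = z \<otimes> (inv z \<otimes> conj b z) \<otimes> inv (conj b y)"
    using eq by simp
  then have "z \<otimes> inv y = conj b z \<otimes> inv (conj b y)" by (simp add: group_word_simps)
  moreover have "conj b (z \<otimes> inv y) = conj b z \<otimes> inv (conj b y)" by (simp add: conj_mult conj_inv)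
  ultimately have "conj b (z \<otimes> inv y) = z \<otimes> inv y" by simp
  then have "z \<otimes> inv y = \<one>" using fixed_point_free[OF b, of "z \<otimes> inv y"] yz by simp
  then show ?thesis using inv_equality[of z "inv y"] by simp
qed

text \<open>
  This replaces a Sylow subgroup that \<^term>\<open>b\<close> preserves only up to conjugation by an
  invariant one.
\<close>
lemma twist_surj:
  assumes b: "b \<in> B" "b \<noteq> \<one>" and W: "subgroup W G" "W \<subseteq> V" and inv: "\<And>w. w \<in> W \<Longrightarrow> conj b w \<in> W"
    and x: "x \<in> W"
  shows "\<exists>y\<in>W. x = inv y \<otimes> conj b y"
proof -
  interpret W: subgroup W G by (rule W)
  let ?t = "\<lambda>y. inv y \<otimes> conj b y"
  have "finite W" using W(2) finite_V finite_subset by blast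
  moreover have "?t ` W \<subseteq> W" using inv by auto
  moreover have "inj_on ?t W"
  proof (rule inj_onI)
    fix y z assume "y \<in> W" "z \<in> W" "?t y = ?t z"
    then show "y = z" using twist_inj[OF b, of y z] W(2) by blast
  qed
  ultimately have "?t ` W = W" by (rule endo_inj_surj)
  then have "x \<in> ?t ` W" using x by simp
  then show ?thesis by blast
qed

lemma conj_commute:
  assumes "a \<in> B" "b \<in> B" "U \<subseteq> carrier G"
  shows "conj a ` conj b ` U = conj b ` conj a ` U"
  using assms B_comm[of a b] by (simp add: conj_image_conj_image)

text \<open>A Sylow \<open>p\<close>-subgroup \<open>R\<close> of \<open>V\<close> that is invariant
  under all of \<open>B\<close> equals \<open>V\<close> by \<open>minimal_V\<close>. Invariance
  under one \<open>b \<noteq> \<one>\<close> is arranged by a suitable conjugation. For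
  \<open>c\<close> in \<open>B\<close> the conjugate of \<open>R\<close> by \<open>c\<close> is
  again \<open>b\<close>-invariant because \<open>B\<close> is commutative, and two
  \<open>b\<close>-invariant Sylow subgroups coincide.\<close>

lemma card_V_prime_power:
  assumes p: "Factorial_Ring.prime (p::nat)" and dvd: "p dvd card V"
  shows "\<exists>k>0. card V = p ^ k"
proof -
  have cV: "card V \<noteq> 0" using finite_V V.one_closed card_0_eq by blast
  obtain m where m: "card V = p ^ multiplicity p (card V) * m" using multiplicity_dvd[of p "card V"] by (auto elim: dvdE)
  define k where "k = multiplicity p (card V)"
  have k0: "k > 0" unfolding k_def using p dvd cV by (simp add: prime_multiplicity_gt_zero_iff)
  have ndvd: "\<not> p dvd m"
  proof
    assume "p dvd m"
    then have "p ^ Suc k dvd card V" by (subst m) (simp add: k_def mult.commute mult_dvd_mono)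
    then have "Suc k \<le> k" unfolding k_def using p cV by (intro multiplicity_geI) (auto simp: prime_nat_iff)
    then show False by simp
  qed
  note card = m[folded k_def] ndvd
  interpret VG: group "G\<lparr>carrier := V\<rparr>" using V_subgroup by (rule subgroup_imp_group)
  obtain P where "subgroup P (G\<lparr>carrier := V\<rparr>)" and cardP: "card P = p ^ k"
    using sylow_thm[OF p VG.group_axioms, of k m] card finite_V by (auto simp: order_def)
  then have P: "subgroup P G" "P \<subseteq> V"
    using incl_subgroup[OF V_subgroup] subgroup.subset by fastforce+
  have PG: "P \<subseteq> carrier G" using P V.subset by blast
  have conjP: "subgroup (conj g ` P) G" "card (conj g ` P) = p ^ k" "conj g ` P \<subseteq> V" if "g \<in> carrier G" for g
    using that P PG cardP conj_image_subgroup[OF that] conj_inj_on[OF that PG]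
    by (auto simp: card_image)
  obtain b where b: "b \<in> B" "b \<noteq> \<one>" using B_nontrivial B.one_closed by blast
  have bG [simp]: "b \<in> carrier G" using b by simp
  obtain x where x: "x \<in> V" "conj x ` P = conj b ` P"
    using subgroup_sylow_conjugate[OF p V_subgroup finite_V card conjP[OF bG] P(1) cardP P(2)] .
  \<comment> \<open>The equation amounts to \<open>conj b y \<otimes> x = y\<close>, which is what
    makes the conjugate of \<open>P\<close> by \<open>y\<close> invariant under
    \<open>b\<close>.\<close>
  obtain y where y: "y \<in> V" "inv x = inv y \<otimes> conj b y"
    using twist_surj[OF b V_subgroup subset_refl conj_V[OF bG] V.m_inv_closed[OF x(1)]] by blast
  define R where "R = conj y ` P"
  have [simp]: "x \<in> carrier G" "y \<in> carrier G" using x y by auto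
  have R: "subgroup R G" "card R = p ^ k" "R \<subseteq> V" using conjP[of y] by (auto simp: R_def)
  have RG: "R \<subseteq> carrier G" using R V.subset by blast
  have "conj b y \<otimes> x = y"
  proof -
    have "y \<otimes> inv x \<otimes> x = y \<otimes> (inv y \<otimes> conj b y) \<otimes> x" using y(2) by simp
    then show ?thesis by (simp add: group_word_simps)
  qed
  moreover have "conj b ` R = conj (conj b y) ` conj b ` P"
    unfolding R_def using PG by (simp add: conj_image_conj_image) (simp add: conj_def group_word_simps)
  ultimately have b_inv: "conj b ` R = R"
    unfolding x(2)[symmetric] R_def using PG by (simp add: conj_image_conj_image)
  have "conj c ` R = R" if c: "c \<in> B" for c
  proof -
    have cG [simp]: "c \<in> carrier G" using c by simp
    have cR: "subgroup (conj c ` R) G" "card (conj c ` R) = p ^ k" "conj c ` R \<subseteq> V"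
      using R conj_image_subgroup[OF cG R(1)] conj_inj_on[OF cG RG] by (auto simp: card_image)
    obtain w where w: "w \<in> V" "conj w ` R = conj c ` R"
      using subgroup_sylow_conjugate[OF p V_subgroup finite_V card cR R] .
    have [simp]: "w \<in> carrier G" using w by simp
    \<comment> \<open>The normalizer of \<open>R\<close> in \<open>V\<close>. It is
      \<open>b\<close>-invariant because \<open>R\<close> is, so \<open>twist_surj\<close> applies
      to it as well.\<close>
    define M where "M = {v \<in> V. conj v ` R = R}"
    have M: "subgroup M G" "M \<subseteq> V"
    proof -
      show "subgroup M G"
      proof (rule subgroupI)
        show "M \<subseteq> carrier G" by (auto simp: M_def)
        show "M \<noteq> {}" using V.one_closed conj_one_image[OF RG] unfolding M_def by blast
      next
        fix v assume "v \<in> M"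
        then have v: "v \<in> V" "conj v ` R = R" by (auto simp: M_def)
        have "conj (inv v) ` R = R" using conj_inv_image[OF _ RG, of v] v by simp
        then show "inv v \<in> M" using v(1) by (simp add: M_def)
      next
        fix u v assume "u \<in> M" "v \<in> M"
        then have uv: "u \<in> V" "conj u ` R = R" "v \<in> V" "conj v ` R = R" by (auto simp: M_def)
        have "conj (u \<otimes> v) ` R = R"
          using conj_image_conj_image[of u v R] RG uv by simp
        then show "u \<otimes> v \<in> M" using uv by (simp add: M_def)
      qed
    qed (auto simp: M_def)
    have inv_b: "conj (inv b) ` R = R"
      using conj_inv_image[OF bG RG] b_inv by simp
    have Mb: "conj b v \<in> M" if "v \<in> M" for v
    proof -
      have v: "v \<in> V" "conj v ` R = R" using that by (auto simp: M_def)
      have "conj (conj b v) ` R = conj b ` conj v ` conj (inv b) ` R"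
        using v(1) RG unfolding conj_def[of b v] by (simp add: conj_image_conj_image m_assoc)
      then show ?thesis using v inv_b b_inv by (simp add: M_def)
    qed
    \<comment> \<open>Both \<open>w\<close> and \<open>conj b w\<close> carry \<open>R\<close> to
      its conjugate by \<open>c\<close>, so they differ by an element of \<open>M\<close>. This
      element is also the twist of some \<open>u\<close> in \<open>M\<close>, and injectivity on
      \<open>V\<close> gives \<open>w = u\<close>.\<close>
    have "conj (conj b w) ` R = conj b ` conj w ` conj (inv b) ` R"
      using RG unfolding conj_def[of b w] by (simp add: conj_image_conj_image m_assoc)
    also have "\<dots> = conj c ` conj b ` R" using inv_b w(2) conj_commute[OF b(1) c RG] by simp
    also have "\<dots> = conj w ` R" using b_inv w(2) by simp
    finally have "conj (inv w) ` conj (conj b w) ` R = conj (inv w) ` conj w ` R" by simp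
    also have "\<dots> = R" using RG by (simp add: conj_inv_image)
    finally have "conj (inv w \<otimes> conj b w) ` R = R" using RG by (simp add: conj_image_conj_image)
    then have "inv w \<otimes> conj b w \<in> M" using w(1) by (simp add: M_def)
    then obtain u where u: "u \<in> M" "inv w \<otimes> conj b w = inv u \<otimes> conj b u"
      using twist_surj[OF b M Mb] by meson
    then have "w = u" using twist_inj[OF b w(1), of u] M(2) by blast
    then show ?thesis using u(1) w(2) by (simp add: M_def)
  qed
  then have "R = {\<one>} \<or> R = V" using minimal_V[OF R(1,3)] by blast
  moreover have "R \<noteq> {\<one>}"
  proof
    assume "R = {\<one>}"
    then have "p ^ k = 1" using R(2) by simp
    then show False using k0 prime_gt_1_nat[OF p] by simp
  qed
  ultimately show ?thesis using R(2) k0 by auto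
qed

section \<open>The kernel is elementary abelian\<close>

text \<open>The center of the nontrivial \<open>p\<close>-group \<open>V\<close> is nontrivial, by a
  second fixed point of \<open>V\<close> acting on itself, and it is invariant under
  \<open>B\<close>; so \<open>minimal_V\<close> makes it all of \<open>V\<close>.\<close>

lemma V_comm:
  assumes "v \<in> V" "w \<in> V"
  shows "v \<otimes> w = w \<otimes> v"
proof -
  obtain p where p: "Factorial_Ring.prime p" "p dvd card V" using ex_prime_dvd_card_V by blast
  obtain k where k: "card V = p ^ k" using card_V_prime_power[OF p] by blast
  interpret A: group_action "G\<lparr>carrier := V\<rparr>" V "\<lambda>g. \<lambda>x\<in>V. conj g x"
    by (rule conj_action) (use V_subgroup V.subset in auto)
  obtain z where z: "z \<in> V" "z \<noteq> \<one>" "\<And>v. v \<in> V \<Longrightarrow> conj v z = z"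
    using A.p_group_second_fixed_point[OF p(1), of k \<one>] k finite_V p(2) by (auto simp: order_def)
  define Z where "Z = {z \<in> V. \<forall>v\<in>V. conj v z = z}"
  have "subgroup Z G"
  proof (rule subgroupI)
    show "Z \<noteq> {}" using z by (auto simp: Z_def)
  qed (auto simp: Z_def conj_mult conj_inv)
  moreover have "conj b z \<in> Z" if b: "b \<in> B" and z: "z \<in> Z" for b z
  proof -
    have "conj v (conj b z) = conj b z" if v: "v \<in> V" for v
    proof -
      have "conj v (conj b z) = conj b (conj (conj (inv b) v) z)"
        using b v z by (simp add: Z_def conj_def group_word_simps)
      then show ?thesis using z b v by (simp add: Z_def)
    qed
    then show ?thesis using b z by (simp add: Z_def)
  qed
  moreover have "Z \<subseteq> V" "Z \<noteq> {\<one>}" using z by (auto simp: Z_def)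
  ultimately have "Z = V" using minimal_V by blast
  then have "conj v w = w" using assms by (auto simp: Z_def)
  then show ?thesis using assms by (simp add: conj_eq_self_iff)
qed

text \<open>In the abelian group \<open>V\<close> the elements killed by \<open>p\<close> form a
  \<open>B\<close>-invariant subgroup, nontrivial by Cauchy's theorem.\<close>

lemma V_exponent:
  assumes p: "Factorial_Ring.prime p" "p dvd card V" and "v \<in> V"
  shows "v [^] p = \<one>"
proof -
  obtain x where x: "x \<in> V" "x \<noteq> \<one>" "x [^] p = \<one>"
    using subgroup_cauchy[OF p(1) V_subgroup finite_V p(2)] .
  define W where "W = {v \<in> V. v [^] p = \<one>}"
  have "subgroup W G"
  proof (rule subgroupI)
    show "W \<noteq> {}" using x by (auto simp: W_def)
  qed (use V_comm in \<open>auto simp: W_def pow_mult_distrib nat_pow_inv\<close>)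
  moreover have "conj b w \<in> W" if "b \<in> B" "w \<in> W" for b w
    using that by (auto simp: W_def simp flip: conj_pow)
  moreover have "W \<subseteq> V" "W \<noteq> {\<one>}" using x by (auto simp: W_def)
  ultimately have "W = V" using minimal_V by blast
  then show ?thesis using assms(3) by (auto simp: W_def)
qed

text \<open>A subgroup of \<open>B\<close> of order \<open>p\<close> would have a second fixed point
  on \<open>V\<close>, whose size \<open>p\<close> divides, against
  \<open>fixed_point_free\<close>.\<close>

lemma prime_not_dvd_card_B:
  assumes p: "Factorial_Ring.prime p" "p dvd card V"
  shows "\<not> p dvd card B"
proof
  assume "p dvd card B"
  then obtain C where C: "subgroup C G" "C \<subseteq> B" "card C = p"
    using subgroup_of_prime_order[OF p(1) B finite_B] by blast
  interpret C: subgroup C G by (rule C)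
  interpret A: group_action "G\<lparr>carrier := C\<rparr>" V "\<lambda>g. \<lambda>x\<in>V. conj g x"
    by (rule conj_action) (use C V.subset in auto)
  obtain z where z: "z \<in> V" "z \<noteq> \<one>" "\<And>c. c \<in> C \<Longrightarrow> conj c z = z"
    using A.p_group_second_fixed_point[OF p(1), of 1 \<one>] C(3) finite_V p(2) V.one_closed
    by (auto simp: order_def)
  have "C \<noteq> {\<one>}" using C(3) prime_gt_1_nat[OF p(1)] by auto
  then obtain c where "c \<in> C" "c \<noteq> \<one>" using C.one_closed by auto
  then show False using fixed_point_free[of c z] z C(2) by auto
qed

section \<open>Trace sums and cyclicity of the complement\<close>

sublocale VC: comm_group "G\<lparr>carrier := V\<rparr>"
  using V_comm subgroup_imp_group[OF V_subgroup] by (intro group.group_comm_groupI) auto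

text \<open>Conjugation by \<open>x\<close> shifts the factors cyclically, so the product is fixed
  by \<open>x\<close> and must be trivial. Here \<open>m\<close> may be any positive multiple of the
  order of \<open>x\<close>.\<close>

lemma conj_orbit_prod:
  assumes x: "x \<in> B" "x \<noteq> \<one>" "x [^] m = \<one>" "m > (0::nat)" and w: "w \<in> V"
  shows "finprod (G\<lparr>carrier := V\<rparr>) (\<lambda>i. conj (x [^] i) w) {..<m} = \<one>"
proof -
  obtain n where n: "m = Suc n" using x(4) gr0_implies_Suc by blast
  define f where "f i = conj (x [^] i) w" for i :: nat
  have [simp]: "x \<in> carrier G" "w \<in> carrier G" using x w by auto
  have fV [simp]: "f i \<in> V" for i using w by (simp add: f_def)
  let ?F = "finprod (G\<lparr>carrier := V\<rparr>) f {..n}"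
  have FV: "?F \<in> V" using VC.finprod_closed[of f "{..n}"] by simp
  have hom: "conj x \<in> hom (G\<lparr>carrier := V\<rparr>) (G\<lparr>carrier := V\<rparr>)"
    by (rule homI) (auto simp: conj_mult)
  have "conj x ?F = finprod (G\<lparr>carrier := V\<rparr>) (\<lambda>i. conj x (f i)) {..n}"
    by (rule finprod_hom[OF VC.comm_monoid_axioms VC.comm_monoid_axioms hom]) auto
  also have "\<dots> = finprod (G\<lparr>carrier := V\<rparr>) (\<lambda>i. f (Suc i)) {..n}"
  proof (rule VC.finprod_cong')
    fix i show "conj x (f i) = f (Suc i)"
      unfolding f_def nat_pow_Suc2[OF \<open>x \<in> carrier G\<close>] by (simp add: conj_conj)
  qed auto
  finally have shift: "conj x ?F = finprod (G\<lparr>carrier := V\<rparr>) (\<lambda>i. f (Suc i)) {..n}" .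
  \<comment> \<open>The product over \<open>{..Suc n}\<close> is split once at its first and once at
    its last factor; these are equal because \<open>x [^] Suc n = \<one>\<close>.\<close>
  have "conj x ?F \<otimes> f 0 = finprod (G\<lparr>carrier := V\<rparr>) f {..Suc n}"
    using VC.finprod_Suc2[of f n] unfolding shift by simp
  also have "\<dots> = f (Suc n) \<otimes> ?F"
    using VC.finprod_Suc[of f n] by simp
  also have "f (Suc n) = f 0" using x(3) n by (simp add: f_def del: nat_pow_Suc)
  finally have "conj x ?F \<otimes> f 0 = ?F \<otimes> f 0" using V_comm[OF fV FV] by simp
  then have "conj x ?F = ?F" using FV by (subst (asm) r_cancel) auto
  then have "?F = \<one>" using fixed_point_free[OF x(1,2) FV] by blast
  then show ?thesis by (simp add: n lessThan_Suc_atMost f_def[abs_def])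
qed

text \<open>
  Write $V$ additively and let $m$ be the order of $b$. If no $b^i c$ is trivial, then each of them
  annihilates $v$ in the trace sum over its powers. Adding these $m$ sums gives
  $0 = \<Sum>_i \<Sum>_j (b^i c)^j v = \<Sum>_j (\<Sum>_i (b^j)^i) c^j v = m v$.
\<close>
lemma torsion_in_powers:
  assumes b: "b \<in> B" "b [^] m = \<one>" "\<And>j. \<lbrakk>0 < j; j < m\<rbrakk> \<Longrightarrow> b [^] j \<noteq> \<one>" and m: "m > (0::nat)"
    and c: "c \<in> B" "c [^] m = \<one>"
    and p: "Factorial_Ring.prime p" "p dvd card V" "coprime m p"
  shows "\<exists>i::nat. c = inv b [^] i"
proof (rule ccontr)
  assume none: "\<nexists>i::nat. c = inv b [^] i"
  have [simp]: "b \<in> carrier G" "c \<in> carrier G" using b c by auto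
  have bi: "b [^] i \<in> B" and ci: "c [^] i \<in> B" for i :: nat
    using b c by (induction i) auto
  define x where "x i = b [^] i \<otimes> c" for i :: nat
  have xB: "x i \<in> B" for i using bi c by (simp add: x_def)
  have x_pow: "x i [^] j = (b [^] j) [^] i \<otimes> c [^] j" for i j :: nat
  proof -
    have "x i [^] j = (b [^] i) [^] j \<otimes> c [^] j"
      unfolding x_def by (rule pow_mult_distrib[OF B_comm[OF bi c(1)]]) simp_all
    then show ?thesis by (simp add: nat_pow_pow mult.commute)
  qed
  \<comment> \<open>This is the point of assuming that \<open>c\<close> is no power of
    \<open>inv b\<close>.\<close>
  have x_ne: "x i \<noteq> \<one>" for i
  proof
    assume "x i = \<one>"
    then have "c \<otimes> b [^] i = \<one>" using B_comm[OF bi c(1)] by (simp add: x_def)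
    then have "c = inv (b [^] i)" using inv_equality[of c "b [^] i"] by simp
    then have "c = inv b [^] i" by (simp add: nat_pow_inv)
    then show False using none by blast
  qed
  have "v = \<one>" if v: "v \<in> V" for v
  proof -
    let ?P = "finprod (G\<lparr>carrier := V\<rparr>)"
    have [simp]: "v \<in> carrier G" using v by simp
    have vm: "v [^] m \<in> V" using v by (induction m) auto
    have "?P (\<lambda>j. conj (x i [^] j) v) {..<m} = \<one>" for i
      using x_pow[of i m] b(2) c(2) by (intro conj_orbit_prod xB x_ne m v) (simp add: nat_pow_pow)
    then have "\<one> = ?P (\<lambda>i. ?P (\<lambda>j. conj (x i [^] j) v) {..<m}) {..<m}"
      using VC.finprod_one[of "{..<m}"] by simp
    also have "\<dots> = ?P (\<lambda>j. ?P (\<lambda>i. conj (x i [^] j) v) {..<m}) {..<m}"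
      by (rule VC.finprod_swap) (use xB v in auto)
    also have "\<dots> = ?P (\<lambda>j. if 0 = j then v [^] m else \<one>) {..<m}"
    proof (rule VC.finprod_cong')
      fix j assume "j \<in> {..<m}"
      then have j: "j < m" by simp
      \<comment> \<open>For fixed \<open>j\<close> the inner product is the trace of
        \<open>conj (c [^] j) v\<close> under \<open>b [^] j\<close>, which is trivial unless
        \<open>j = 0\<close>.\<close>
      have eq: "conj (x i [^] j) v = conj ((b [^] j) [^] i) (conj (c [^] j) v)" for i
        by (simp add: x_pow conj_conj)
      show "?P (\<lambda>i. conj (x i [^] j) v) {..<m} = (if 0 = j then v [^] m else \<one>)"
      proof (cases "j = 0")
        case True
        then have "?P (\<lambda>i. conj (x i [^] j) v) {..<m} = ?P (\<lambda>i. v) {..<m}" by simp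
        also have "\<dots> = v [^] m"
          using VC.finprod_const[of v "{..<m}"] v by (simp add: nat_pow_consistent[symmetric])
        finally show ?thesis using True by simp
      next
        case False
        have "(b [^] j) [^] m = (b [^] m) [^] j" by (simp add: nat_pow_pow mult.commute)
        then have "(b [^] j) [^] m = \<one>" using b(2) by simp
        then have "?P (\<lambda>i. conj ((b [^] j) [^] i) (conj (c [^] j) v)) {..<m} = \<one>"
          using False j m v bi b(3) by (intro conj_orbit_prod) auto
        then show ?thesis using False by (simp add: eq)
      qed
    qed (use v vm in auto)
    also have "\<dots> = v [^] m"
      using VC.finprod_singleton[of 0 "{..<m}" "\<lambda>_. v [^] m"] vm m by (simp cong: if_cong)
    \<comment> \<open>Both \<open>m\<close> and \<open>p\<close> annihilate \<open>v\<close>, and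
      they are coprime.\<close>
    finally show "v = \<one>" using pow_eq_one_coprime[of v m p] V_exponent[OF p(1,2) v] p(3) by simp
  qed
  then show False using V_nontrivial V.one_closed by blast
qed

text \<open>If \<open>b\<close> has maximal order, all orders in \<open>B\<close> divide
  \<open>?m\<close>, so \<open>torsion_in_powers\<close> applies to every \<open>c\<close>. Since
  \<open>?m\<close> divides \<open>card B\<close>, it is prime to \<open>p\<close>. The generator
  found in this way is \<open>inv b\<close>.\<close>

theorem cyclic_B: "cyclic_group (G\<lparr>carrier := B\<rparr>)"
proof -
  obtain p where p: "Factorial_Ring.prime p" "p dvd card V" using ex_prime_dvd_card_V by blast
  have ords: "finite (GB.ord ` B)" "GB.ord ` B \<noteq> {}" using finite_B B.one_closed by blast+
  obtain b where b: "b \<in> B" "Max (GB.ord ` B) = GB.ord b" using Max_in[OF ords] by blast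
  have b_max: "GB.ord y \<le> GB.ord b" if "y \<in> B" for y
    using Max_ge[OF ords(1), of "GB.ord y"] that b(2) by simp
  let ?m = "GB.ord b"
  have pow: "y [^] n = \<one> \<longleftrightarrow> GB.ord y dvd n" if "y \<in> B" for y and n :: nat
    using GB.pow_eq_id[of y n] that by (simp add: nat_pow_consistent[symmetric])
  have m: "?m > 0" using GB.ord_ge_1[of b] finite_B b(1) by simp
  have "?m dvd card B" using GB.ord_dvd_group_order[of b] b(1) by (simp add: order_def)
  then have "\<not> p dvd ?m" using prime_not_dvd_card_B[OF p] by (meson dvd_trans)
  then have cop: "coprime ?m p" using prime_imp_coprime[OF p(1)] coprime_commute by blast
  have "\<exists>i::nat. c = inv b [^] i" if c: "c \<in> B" for c
  proof (rule torsion_in_powers[OF b(1) _ _ m c _ p cop])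
    show "b [^] ?m = \<one>" using pow[OF b(1)] by simp
    show "b [^] j \<noteq> \<one>" if "0 < j" "j < ?m" for j using pow[OF b(1)] that nat_dvd_not_less by blast
    show "c [^] ?m = \<one>" using pow[OF c] GB.max_ord_dvd[of b c] finite_B b(1) b_max c by simp
  qed
  then have "B \<subseteq> range (\<lambda>n::int. inv b [^]\<^bsub>G\<lparr>carrier := B\<rparr>\<^esub> n)"
    using b(1) by (force simp: int_pow_consistent[OF B, symmetric] simp flip: int_pow_int)
  moreover have "range (\<lambda>n::int. inv b [^]\<^bsub>G\<lparr>carrier := B\<rparr>\<^esub> n) \<subseteq> B"
    using GB.int_pow_closed[of "inv b"] b(1) by auto
  ultimately show ?thesis using b(1) unfolding GB.cyclic_group by (intro bexI[of _ "inv b"]) auto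
qed

end

section \<open>Self-normalizing maximal abelian subgroups\<close>

text \<open>Modulo \<open>H\<close> the factor \<open>x\<close> disappears; the phrasing with
  elements avoids forming a further quotient.\<close>

lemma (in normal) mult_pow_mod:
  assumes "x \<in> H" "g \<in> carrier G"
  shows "(x \<otimes> g) [^] n \<otimes> inv (g [^] (n::nat)) \<in> H"
proof (induction n)
  case 0
  then show ?case by simp
next
  case (Suc n)
  have [simp]: "x \<in> carrier G" using assms(1) by simp
  have "(x \<otimes> g) [^] Suc n \<otimes> inv (g [^] Suc n)
      = ((x \<otimes> g) [^] n \<otimes> inv (g [^] n)) \<otimes> (g [^] n \<otimes> x \<otimes> inv (g [^] n))"
    using assms(2) by (simp add: group_word_simps)
  then show ?case using Suc assms inv_op_closed2 by simp
qed

lemma (in group) rcos_eq_iff: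
  assumes H: "subgroup H G" and "x \<in> carrier G" "y \<in> carrier G"
  shows "H #> x = H #> y \<longleftrightarrow> x \<otimes> inv y \<in> H"
proof
  assume "H #> x = H #> y"
  then have "x \<in> H #> y" using rcos_self[OF assms(2) H] by simp
  then show "x \<otimes> inv y \<in> H" using subgroup.rcos_module_imp[OF H group_axioms assms(3)] by simp
next
  assume "x \<otimes> inv y \<in> H"
  then have "x \<in> H #> y" using subgroup.rcos_module_rev[OF H group_axioms assms(3,2)] by simp
  then show "H #> x = H #> y" using repr_independence[OF _ assms(3) H] by simp
qed

locale abelian_maximal = group +
  fixes A
  assumes fin: "finite (carrier G)"
    and A: "subgroup A G"
    and A_comm: "\<lbrakk>a \<in> A; b \<in> A\<rbrakk> \<Longrightarrow> a \<otimes> b = b \<otimes> a"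
    and A_max: "\<lbrakk>subgroup K G; A \<subseteq> K\<rbrakk> \<Longrightarrow> K = A \<or> K = carrier G"
    and A_proper: "A \<noteq> carrier G"
    and A_selfnormal: "\<lbrakk>g \<in> carrier G; conj g ` A = A\<rbrakk> \<Longrightarrow> g \<in> A"
begin

sublocale A: subgroup A G by (rule A)

lemma finite_A: "finite A"
  using A.subset fin finite_subset by blast

text \<open>Introduced as the center, so that its elements commute with everything by definition;
  \<open>core_eq_N\<close> shows that it is the core of \<open>A\<close>.\<close>

definition N where "N = center G"

lemma N_iff: "z \<in> N \<longleftrightarrow> z \<in> carrier G \<and> (\<forall>g\<in>carrier G. conj g z = z)"
  unfolding N_def center_def by (auto simp: conj_eq_self_iff)

lemma N_comm: "\<lbrakk>z \<in> N; g \<in> carrier G\<rbrakk> \<Longrightarrow> z \<otimes> g = g \<otimes> z"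
  by (simp add: N_def center_def)

sublocale N: normal N G
proof -
  have "subgroup N G"
  proof (rule subgroupI)
    have "\<one> \<in> N" by (simp add: N_iff)
    then show "N \<noteq> {}" by blast
  qed (auto simp: N_iff conj_inv conj_mult)
  then show "N \<lhd> G" unfolding normal_inv_iff conj_def[symmetric] by (simp add: N_iff)
qed

lemma conj_N [simp]: "\<lbrakk>z \<in> N; g \<in> carrier G\<rbrakk> \<Longrightarrow> conj g z = z"
  using N_iff by blast

lemma N_subset_A: "N \<subseteq> A"
proof
  fix z assume z: "z \<in> N"
  have "conj z ` A = (\<lambda>x. x) ` A"
  proof (rule image_cong)
    fix a assume a: "a \<in> A"
    then show "conj z a = a" using N_comm[OF z, of a] z by (simp add: conj_eq_self_iff)
  qed simp
  then have "conj z ` A = A" by simp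
  then show "z \<in> A" using A_selfnormal N.mem_carrier[OF z] by blast
qed

lemma N_in_A [simp]: "z \<in> N \<Longrightarrow> z \<in> A"
  using N_subset_A by blast

text \<open>An element of two distinct conjugates of \<^term>\<open>A\<close> is centralized by the group they generate.\<close>
lemma A_malnormal:
  assumes g: "g \<in> carrier G" "g \<notin> A" and a: "a \<in> A" "conj g a \<in> A"
  shows "a \<in> N"
proof -
  define c where "c = conj g a"
  have c: "c \<in> A" using a by (simp add: c_def)
  \<comment> \<open>The centralizer of \<open>c\<close>; it contains \<open>A\<close>, so by
    maximality it is \<open>A\<close> or everything.\<close>
  define K where "K = {x \<in> carrier G. conj x c = c}"
  have "subgroup K G"
  proof (rule subgroupI)
    show "K \<noteq> {}" using c one_closed by (auto simp: K_def intro!: exI[of _ \<one>])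
    show "inv x \<in> K" if "x \<in> K" for x
      using that c conj_conj_inv(2)[of x c] by (simp add: K_def)
    show "x \<otimes> y \<in> K" if "x \<in> K" "y \<in> K" for x y
      using that c by (simp add: K_def flip: conj_conj)
  qed (auto simp: K_def)
  moreover have "A \<subseteq> K"
    using A_comm c by (auto simp: K_def conj_eq_self_iff)
  ultimately consider "K = A" | "K = carrier G" using A_max by blast
  then have "K = carrier G"
  proof cases
    case 1
    \<comment> \<open>As \<open>a\<close> commutes with \<open>A\<close>, its conjugate
      \<open>c\<close> commutes with the conjugate of \<open>A\<close> by \<open>g\<close>. If
      \<open>K = A\<close>, then \<open>g\<close> would normalize \<open>A\<close>.\<close>
    have "conj g ` A \<subseteq> K"
    proof (rule image_subsetI)
      fix b assume b: "b \<in> A"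
      then have "conj b a = a" using a A_comm by (simp add: conj_eq_self_iff)
      have "conj (conj g b) c = conj g (conj b a)"
        using g a b by (simp add: c_def conj_def group_word_simps)
      then show "conj g b \<in> K" using \<open>conj b a = a\<close> g b by (simp add: K_def c_def)
    qed
    then have "conj g ` A = A" using 1 conj_image_eq_of_subset[OF g(1) A.subset finite_A] by simp
    then show ?thesis using A_selfnormal g by blast
  qed
  then have "c \<in> N" unfolding N_iff K_def using c by auto
  then have "conj (inv g) c = c" using g by simp
  then have "a = c" using g a by (simp add: c_def)
  then show ?thesis using \<open>c \<in> N\<close> by simp
qed

text \<open>An element of the core lies in \<open>A\<close> together with its conjugate by some
  \<open>g\<close> outside \<open>A\<close>, so \<open>A_malnormal\<close> applies to it.\<close>

lemma core_eq_N: "core G A = N"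
proof -
  have conj_coset: "(inv g <# A) #> g = conj (inv g) ` A" if "g \<in> carrier G" for g
    using conj_set_eq[of "inv g" A] that A.subset by simp
  have "core G A = (\<Inter>g\<in>carrier G. conj (inv g) ` A)"
    unfolding core_def by (rule INF_cong) (simp_all add: conj_coset)
  also have "\<dots> = N"
  proof
    show "(\<Inter>g\<in>carrier G. conj (inv g) ` A) \<subseteq> N"
    proof
      fix x assume x: "x \<in> (\<Inter>g\<in>carrier G. conj (inv g) ` A)"
      obtain g where g: "g \<in> carrier G" "g \<notin> A" using A_proper A.subset by blast
      have "conj g x \<in> A" if g: "g \<in> carrier G" for g
      proof -
        obtain a where "a \<in> A" "x = conj (inv g) a" using x g by blast
        then show ?thesis using g by simp
      qed
      moreover have "x \<in> A"
      proof -
        obtain a where "a \<in> A" "x = conj (inv \<one>) a" using x one_closed by blast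
        then show ?thesis by simp
      qed
      ultimately show "x \<in> N" using A_malnormal[OF g] g(1) by blast
    qed
    show "N \<subseteq> (\<Inter>g\<in>carrier G. conj (inv g) ` A)"
    proof (rule subsetI, rule INT_I)
      fix x g assume "x \<in> N" "g \<in> carrier G"
      then have "x = conj (inv g) x" "x \<in> A" by simp_all
      then show "x \<in> conj (inv g) ` A" by (rule image_eqI)
    qed
  qed
  finally show ?thesis .
qed

section \<open>The quotient by the center\<close>

abbreviation quot :: "'a \<Rightarrow> 'a set" ("\<pi>")
  where "\<pi> x \<equiv> N #> x"

definition B where "B = \<pi> ` A"

sublocale Q: group "G Mod N"
  by (rule N.factorgroup_is_group)

sublocale quot: group_hom G "G Mod N" \<pi>
  using N.r_coset_hom_Mod N.factorgroup_is_group group_axioms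
  by (simp add: group_hom_def group_hom_axioms_def)

declare quot.hom_mult [simp del] quot.hom_inv [simp del]

lemma quot_mult [simp]:
  "\<lbrakk>x \<in> carrier G; y \<in> carrier G\<rbrakk> \<Longrightarrow> \<pi> x <#> \<pi> y = \<pi> (x \<otimes> y)"
  by (rule N.rcos_sum)

lemma quot_carrier: "carrier (G Mod N) = \<pi> ` carrier G"
  by (rule carrier_FactGroup)

lemma quot_inv: "x \<in> carrier G \<Longrightarrow> inv\<^bsub>G Mod N\<^esub> \<pi> x = \<pi> (inv x)"
  by (simp add: quot.hom_inv)

lemma quot_pow: "x \<in> carrier G \<Longrightarrow> \<pi> x [^]\<^bsub>G Mod N\<^esub> (n::nat) = \<pi> (x [^] n)"
  by (simp add: quot.hom_nat_pow)

lemma quot_eq_iff: "\<lbrakk>x \<in> carrier G; y \<in> carrier G\<rbrakk> \<Longrightarrow> \<pi> x = \<pi> y \<longleftrightarrow> x \<otimes> inv y \<in> N"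
  by (rule rcos_eq_iff[OF N.subgroup_axioms])

lemma quot_eq_one_iff: "x \<in> carrier G \<Longrightarrow> \<pi> x = N \<longleftrightarrow> x \<in> N"
  using quot_eq_iff[of x \<one>] N.subset by simp

lemma quot_mem_B_iff:
  assumes "x \<in> carrier G"
  shows "\<pi> x \<in> B \<longleftrightarrow> x \<in> A"
proof
  assume "\<pi> x \<in> B"
  then obtain a where a: "a \<in> A" "\<pi> x = \<pi> a" by (auto simp: B_def)
  then have "x \<otimes> inv a \<in> A" using assms quot_eq_iff[of x a] by simp
  then have "x \<otimes> inv a \<otimes> a \<in> A" using a(1) by (rule A.m_closed)
  then show "x \<in> A" using a assms by (simp add: group_word_simps)
qed (simp add: B_def)

lemma conj_quot: "\<lbrakk>g \<in> carrier G; x \<in> carrier G\<rbrakk> \<Longrightarrow> Q.conj (\<pi> g) (\<pi> x) = \<pi> (conj g x)"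
  by (simp add: Q.conj_def conj_def quot_inv)

sublocale Q: malnormal_abelian "G Mod N" B
proof (intro malnormal_abelian.intro malnormal_abelian_axioms.intro)
  show "group (G Mod N)" by (rule Q.group_axioms)
  show "finite (carrier (G Mod N))" using fin by (simp add: quot_carrier)
  show "subgroup B (G Mod N)" unfolding B_def by (rule quot.subgroup_img_is_subgroup) (rule A)
  show "a \<otimes>\<^bsub>G Mod N\<^esub> b = b \<otimes>\<^bsub>G Mod N\<^esub> a" if "a \<in> B" "b \<in> B" for a b
    using that A_comm by (auto simp: B_def)
  fix Z Y assume "Z \<in> carrier (G Mod N)" "Z \<notin> B" "Y \<in> B" "Q.conj Z Y \<in> B"
  moreover from this obtain g a where ga: "g \<in> carrier G" "Z = \<pi> g" "a \<in> A" "Y = \<pi> a"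
    by (auto simp: quot_carrier B_def)
  ultimately have "g \<notin> A" "conj g a \<in> A"
    by (simp_all add: conj_quot quot_mem_B_iff)
  then have "a \<in> N" using A_malnormal ga by blast
  then show "Y = \<one>\<^bsub>G Mod N\<^esub>" using ga by (simp add: quot_eq_one_iff)
qed

lemma ex_complement: "\<exists>V. maximal_malnormal (G Mod N) B V"
proof -
  obtain V where V: "V \<lhd> G Mod N" "V \<inter> B = {\<one>\<^bsub>G Mod N\<^esub>}"
    "\<And>g. g \<in> carrier (G Mod N) \<Longrightarrow> \<exists>v\<in>V. \<exists>b\<in>B. g = v \<otimes>\<^bsub>G Mod N\<^esub> b"
    using Q.normal_complement by metis
  have "maximal_malnormal (G Mod N) B V"
  proof (intro maximal_malnormal.intro maximal_malnormal_axioms.intro)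
    show "malnormal_abelian (G Mod N) B" by (rule Q.malnormal_abelian_axioms)
  next
    fix K assume K: "subgroup K (G Mod N)" "B \<subseteq> K"
    define L where "L = {x \<in> carrier G. \<pi> x \<in> K}"
    have "subgroup L G"
    proof (rule subgroupI)
      show "L \<noteq> {}" using subgroup.one_closed[OF K(1)] by (auto simp: L_def intro!: exI[of _ \<one>])
      show "inv a \<in> L" if "a \<in> L" for a
        using that subgroup.m_inv_closed[OF K(1)] by (auto simp: L_def quot_inv[symmetric])
      show "a \<otimes> b \<in> L" if "a \<in> L" "b \<in> L" for a b
        using that subgroup.m_closed[OF K(1), of "\<pi> a" "\<pi> b"] by (auto simp: L_def)
    qed (auto simp: L_def)
    moreover have "A \<subseteq> L" using K(2) by (auto simp: L_def B_def)
    ultimately have "L = A \<or> L = carrier G" by (rule A_max)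
    moreover have "K = \<pi> ` L" using subgroup.subset[OF K(1)] by (auto simp: L_def quot_carrier)
    ultimately show "K = B \<or> K = carrier (G Mod N)" by (auto simp: B_def quot_carrier)
  next
    show "B \<noteq> {\<one>\<^bsub>G Mod N\<^esub>}"
    proof
      assume "B = {\<one>\<^bsub>G Mod N\<^esub>}"
      then have "\<pi> a = N" if "a \<in> A" for a using that by (auto simp: B_def)
      then have "A \<subseteq> N" using quot_eq_one_iff by auto
      \<comment> \<open>Then \<open>A\<close> is central and normalized by every element, so
        self-normalization makes it the whole group.\<close>
      then have AN: "A = N" using N_subset_A by blast
      have "g \<in> A" if g: "g \<in> carrier G" for g
      proof -
        have "conj g ` A \<subseteq> A" using AN g by auto
        then show ?thesis using A_selfnormal g conj_image_eq_of_subset[OF g A.subset finite_A] by blast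
      qed
      then show False using A_proper A.subset by blast
    qed
    show "B \<noteq> carrier (G Mod N)"
    proof
      assume "B = carrier (G Mod N)"
      then have "carrier G \<subseteq> A" using quot_mem_B_iff by (auto simp: quot_carrier)
      then show False using A_proper A.subset by blast
    qed
  qed (use V in auto)
  then show ?thesis ..
qed

definition V where "V = (SOME V. maximal_malnormal (G Mod N) B V)"

sublocale Q: maximal_malnormal "G Mod N" B V
  unfolding V_def by (rule someI_ex[OF ex_complement])

text \<open>The choice is immaterial: \<open>card V\<close> is a power of each of its prime
  divisors.\<close>

definition p where "p = (SOME p. Factorial_Ring.prime p \<and> p dvd card V)"

lemma p: "Factorial_Ring.prime p" "p dvd card V"
  using someI_ex[OF Q.ex_prime_dvd_card_V] by (simp_all add: p_def)

lemma card_quot_subgroup: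
  assumes "subgroup L G" "N \<subseteq> L"
  shows "card (\<pi> ` L) * card N = card L"
proof -
  interpret L: group "G\<lparr>carrier := L\<rparr>" by (rule subgroup_imp_group) fact
  have "subgroup N (G\<lparr>carrier := L\<rparr>)" using assms N.subgroup_axioms subgroup_incl by blast
  moreover have "rcosets\<^bsub>G\<lparr>carrier := L\<rparr>\<^esub> N = \<pi> ` L" by (auto simp: RCOSETS_def)
  ultimately show ?thesis using L.lagrange[of N] by (simp add: order_def)
qed

lemma card_B_N: "card B * card N = card A"
  unfolding B_def using A N_subset_A by (rule card_quot_subgroup)

lemma cyclic_A_mod_N: "cyclic_group ((G\<lparr>carrier := A\<rparr>) Mod N)"
  and coprime_order_A_mod_N: "coprime (order ((G\<lparr>carrier := A\<rparr>) Mod N)) p"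
proof -
  have car: "rcosets\<^bsub>G\<lparr>carrier := A\<rparr>\<^esub> N = B" by (auto simp: RCOSETS_def B_def)
  \<comment> \<open>Restricting to \<open>A\<close> and then factoring gives the same group as
    factoring and then restricting to \<open>B\<close>.\<close>
  then have "(G\<lparr>carrier := A\<rparr>) Mod N = (G Mod N)\<lparr>carrier := B\<rparr>"
    unfolding FactGroup_def car by (simp add: fun_eq_iff)
  then show "cyclic_group ((G\<lparr>carrier := A\<rparr>) Mod N)" using Q.cyclic_B by simp
  have "coprime p (card B)" using prime_imp_coprime[OF p(1) Q.prime_not_dvd_card_B[OF p]] .
  then show "coprime (order ((G\<lparr>carrier := A\<rparr>) Mod N)) p"
    by (simp add: order_def FactGroup_def car coprime_commute)
qed

end

section \<open>Complements\<close>

text \<open>Bezout coefficients for \<open>r\<close> and \<open>s\<close> split each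
  \<open>a\<close> into a power killed by \<open>s\<close> and one killed by \<open>r\<close>. The
  orders follow from Cauchy's theorem: a prime dividing both \<open>card Q\<close> and
  \<open>r\<close> would give a nontrivial element killed by coprime exponents.\<close>

lemma (in group) abelian_coprime_decomposition:
  assumes A: "subgroup A G" "finite A" and comm: "\<And>a b. a \<in> A \<Longrightarrow> b \<in> A \<Longrightarrow> a \<otimes> b = b \<otimes> a"
    and card: "card A = s * r" "coprime s r"
  defines "Q \<equiv> {a \<in> A. a [^] (s::nat) = \<one>}" and "S \<equiv> {a \<in> A. a [^] (r::nat) = \<one>}"
  shows "inner_direct_product G Q S A" and "card Q = s" and "card S = r"
proof -
  interpret A: subgroup A G by (rule A)
  interpret AG: group "G\<lparr>carrier := A\<rparr>" using A(1) by (rule subgroup_imp_group)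
  have pow_card: "a [^] (s * r) = \<one>" if "a \<in> A" for a
    using AG.pow_order_eq_1[of a] that card(1) by (simp add: order_def flip: nat_pow_consistent)
  have pow_A: "a [^] n \<in> A" if "a \<in> A" for a and n :: nat
    using that by (induction n) auto
  have torsion: "subgroup {a \<in> A. a [^] n = \<one>} G" for n :: nat
  proof (rule subgroupI)
    show "{a \<in> A. a [^] n = \<one>} \<noteq> {}" using A.one_closed nat_pow_one[of n] by blast
  qed (use comm in \<open>auto simp: pow_mult_distrib nat_pow_inv\<close>)
  have Q: "subgroup Q G" and S: "subgroup S G" unfolding Q_def S_def by (rule torsion)+
  have int: "Q \<inter> S = {\<one>}"
  proof -
    have "x = \<one>" if "x \<in> Q" "x \<in> S" for x
      using that pow_eq_one_coprime[of x s r] card(2) by (auto simp: Q_def S_def)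
    then show ?thesis using subgroup.one_closed[OF Q] subgroup.one_closed[OF S] by blast
  qed
  have prod: "Q <#> S = A"
  proof
    show "Q <#> S \<subseteq> A" by (auto simp: set_mult_def Q_def S_def)
    show "A \<subseteq> Q <#> S"
    proof
      fix a assume a: "a \<in> A"
      have "gcd (int r) (int s) = 1" using card(2) by (simp add: coprime_iff_gcd_eq_1 gcd.commute)
      then obtain u v where "u * int r + v * int s = 1" using bezout_int by metis
      then have uv: "int r * u + int s * v = 1" by (simp add: mult.commute)
      let ?x = "(a [^] r) [^] u" and ?y = "(a [^] s) [^] v"
      have aG: "a \<in> carrier G" using a by simp
      have pow_int: "b [^] (n::int) \<in> A" if "b \<in> A" for b n
        using AG.int_pow_closed[of b n] that A(1) by (simp flip: int_pow_consistent)
      have "?x [^] s = ((a [^] r) [^] s) [^] u" "?y [^] r = ((a [^] s) [^] r) [^] v"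
        using aG by (simp_all add: int_pow_pow mult.assoc mult.commute mult.left_commute flip: int_pow_int)
      then have "?x \<in> Q" "?y \<in> S"
        using a pow_A pow_int pow_card[OF a] by (simp_all add: Q_def S_def nat_pow_pow mult.commute)
      moreover have "?x \<otimes> ?y = a [^] (int r * u + int s * v)"
        using aG by (simp add: int_pow_pow int_pow_mult flip: int_pow_int)
      then have "?x \<otimes> ?y = a" unfolding uv using aG by simp
      ultimately show "a \<in> Q <#> S" unfolding set_mult_def by blast
    qed
  qed
  show "inner_direct_product G Q S A"
    unfolding inner_direct_product_def using Q S int prod
  proof (intro conjI ballI)
    show "h \<otimes> k = k \<otimes> h" if "h \<in> Q" "k \<in> S" for h k
      using that comm by (simp add: Q_def S_def)
  qed
  have fin: "finite Q" "finite S" using A(2) by (auto simp: Q_def S_def)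
  have cop: "coprime (card {a \<in> A. a [^] m = \<one>}) n" if "coprime m n" for m n :: nat
  proof (rule ccontr)
    assume "\<not> coprime (card {a \<in> A. a [^] m = \<one>}) n"
    then have "gcd (card {a \<in> A. a [^] m = \<one>}) n \<noteq> 1" by (simp add: coprime_iff_gcd_eq_1)
    then obtain q where "Factorial_Ring.prime q" "q dvd gcd (card {a \<in> A. a [^] m = \<one>}) n"
      using prime_factor_nat by blast
    then have q: "Factorial_Ring.prime q" "q dvd card {a \<in> A. a [^] m = \<one>}" "q dvd n" by simp_all
    have "finite {a \<in> A. a [^] m = \<one>}" using A(2) by simp
    then obtain x where x: "x \<in> {a \<in> A. a [^] m = \<one>}" "x \<noteq> \<one>" "x [^] q = \<one>"
      using subgroup_cauchy[OF q(1) torsion _ q(2)] by blast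
    have "coprime m q" using \<open>coprime m n\<close> q(3) coprime_divisors[of m m q n] by simp
    then show False using pow_eq_one_coprime[of x m q] x by simp
  qed
  have cards: "card Q * card S = s * r"
    using card_set_mult_disjoint[OF Q S int] prod card(1) by simp
  have "coprime (card Q) r" "coprime (card S) s"
    unfolding Q_def S_def using cop[of s r] cop[of r s] card(2) by (simp_all add: coprime_commute)
  \<comment> \<open>Coprimality distributes the product \<open>s * r\<close> over the two orders as
    divisors, and the known product of the orders leaves no room for a smaller one.\<close>
  then have dvd: "card Q dvd s" "card S dvd r"
    using cards by (metis coprime_dvd_mult_left_iff dvd_triv_left, metis coprime_dvd_mult_right_iff dvd_triv_right)
  have pos: "card Q > 0" "card S > 0"
    using fin subgroup.one_closed[OF Q] subgroup.one_closed[OF S] card_gt_0_iff by blast+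
  then have "s * r > 0" unfolding cards[symmetric] by simp
  then have sr: "s > 0" "r > 0" by simp_all
  then have le: "card Q \<le> s" "card S \<le> r" using dvd dvd_imp_le by blast+
  show "card Q = s"
  proof (rule ccontr)
    assume "card Q \<noteq> s"
    then have "card Q * card S < s * card S" using le(1) pos(2) by simp
    also have "\<dots> \<le> s * r" using le(2) by simp
    finally show False using cards by simp
  qed
  then show "card S = r" using cards sr(1) by simp
qed

locale abelian_maximal_complement = abelian_maximal +
  fixes P
  assumes P: "subgroup P G"
    and P_inter_A: "P \<inter> A = {\<one>}"
    and card_P: "card P * card A = order G"
    and P_not_normal: "\<exists>g\<in>carrier G. \<exists>x\<in>P. conj g x \<notin> P"
begin

sublocale P: subgroup P G by (rule P)

lemma P_inter_N: "\<lbrakk>x \<in> P; x \<in> N\<rbrakk> \<Longrightarrow> x = \<one>"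
  using P_inter_A N_subset_A by blast

text \<open>Both have order |G| / |A|; for \<open>V\<close> because |G/N| = |V| |B| and |A| = |B|
  |N|.\<close>

lemma card_V: "card V = card P"
proof -
  have N: "card N > 0" using fin N.one_closed N.subset finite_subset by (metis card_gt_0_iff empty_iff)
  have A0: "card A > 0" using finite_A A.one_closed by (metis card_gt_0_iff empty_iff)
  have "card V * card A = card V * card B * card N" by (simp add: card_B_N)
  also have "\<dots> = order (G Mod N) * card N" by (simp add: Q.card_V_B)
  also have "\<dots> = card (\<pi> ` carrier G) * card N" by (simp add: order_def quot_carrier)
  also have "\<dots> = order G"
    using card_quot_subgroup[OF subgroup_self N.subset] by (simp add: order_def)
  finally have "card V * card A = card P * card A" using card_P by simp
  then show ?thesis using A0 by simp
qed

lemma coprime_card_P_B: "coprime (card P) (card B)"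
proof -
  obtain k where "card P = p ^ k" using Q.card_V_prime_power[OF p] card_V by auto
  moreover have "coprime p (card B)" using prime_imp_coprime[OF p(1) Q.prime_not_dvd_card_B[OF p]] .
  ultimately show ?thesis by simp
qed

text \<open>Split \<open>\<pi> x\<close> as \<open>v <#> b\<close>. Its power with exponent
  \<open>card P\<close> is trivial and agrees modulo \<open>V\<close> with that power of
  \<open>b\<close>, which therefore lies in both \<open>V\<close> and \<open>B\<close>. As
  \<open>card P\<close> is prime to \<open>card B\<close>, \<open>b\<close> is trivial. Equality
  follows by counting, since \<open>P\<close> meets \<open>N\<close> trivially.\<close>

lemma quot_P: "\<pi> ` P = V"
proof -
  have "\<pi> x \<in> V" if x: "x \<in> P" for x
  proof -
    have xG: "x \<in> carrier G" using x by simp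
    then have "\<pi> x \<in> carrier (G Mod N)" by (simp add: quot_carrier)
    then obtain v b where vb: "v \<in> V" "b \<in> B" "\<pi> x = v <#> b" using Q.V_mult_B by force
    have b: "b \<in> carrier (G Mod N)" using vb by simp
    have "(v <#> b) [^]\<^bsub>G Mod N\<^esub> card P = \<one>\<^bsub>G Mod N\<^esub>"
    proof -
      interpret PG: group "G\<lparr>carrier := P\<rparr>" using P by (rule subgroup_imp_group)
      have "x [^] card P = \<one>"
        using PG.pow_order_eq_1[of x] x by (simp add: order_def flip: nat_pow_consistent)
      then show ?thesis using quot_pow[OF xG, of "card P"] vb(3) by simp
    qed
    then have "inv\<^bsub>G Mod N\<^esub> (b [^]\<^bsub>G Mod N\<^esub> card P) \<in> V"
      using Q.V.mult_pow_mod[OF vb(1) b, of "card P"] Q.l_one[OF Q.inv_closed[OF Q.nat_pow_closed[OF b]]]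
      by simp
    then have "b [^]\<^bsub>G Mod N\<^esub> card P \<in> V"
      using Q.V.m_inv_closed[of "inv\<^bsub>G Mod N\<^esub> (b [^]\<^bsub>G Mod N\<^esub> card P)"] b by simp
    moreover have "b [^]\<^bsub>G Mod N\<^esub> n \<in> B" for n :: nat
      using vb(2) by (induction n) (use Q.B.m_closed Q.B.one_closed in auto)
    ultimately have "b [^]\<^bsub>G Mod N\<^esub> card P = \<one>\<^bsub>G Mod N\<^esub>" using Q.V_inter_B by blast
    moreover have "b [^]\<^bsub>G Mod N\<^esub> card B = \<one>\<^bsub>G Mod N\<^esub>"
      using Q.GB.pow_order_eq_1[of b] vb(2)
      by (simp add: order_def Q.nat_pow_consistent[symmetric])
    ultimately have "b = \<one>\<^bsub>G Mod N\<^esub>"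
      using Q.pow_eq_one_coprime[OF b _ _ coprime_card_P_B] by blast
    then show ?thesis using vb Q.V.mem_carrier[OF vb(1)] Q.r_one[of v] by simp
  qed
  then have "\<pi> ` P \<subseteq> V" by blast
  moreover have "inj_on \<pi> P"
  proof (rule inj_onI)
    fix x y assume "x \<in> P" "y \<in> P" "\<pi> x = \<pi> y"
    then have "x \<otimes> inv y = \<one>" using P_inter_N[of "x \<otimes> inv y"] quot_eq_iff[of x y] by simp
    then show "x = y" using \<open>x \<in> P\<close> \<open>y \<in> P\<close> by (metis P.mem_carrier inv_closed inv_equality inv_inv)
  qed
  ultimately show ?thesis using card_V Q.finite_V by (simp add: card_image card_subset_eq)
qed

section \<open>The abelian normal subgroup containing stabilizer and center\<close>

text \<open>As a preimage \<open>K\<close> inherits normality from \<open>V\<close>;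
  \<open>K_iff\<close> identifies it with the product of \<open>P\<close> and
  \<open>N\<close>.\<close>

definition K where "K = {x \<in> carrier G. \<pi> x \<in> V}"

lemma K_carrier: "x \<in> K \<Longrightarrow> x \<in> carrier G"
  and K_quot: "x \<in> K \<Longrightarrow> \<pi> x \<in> V"
  by (simp_all add: K_def)

lemma mod_N_obtain:
  assumes "x \<in> carrier G" "y \<in> carrier G" "\<pi> x = \<pi> y"
  obtains n where "n \<in> N" "x = y \<otimes> n"
proof -
  have n: "x \<otimes> inv y \<in> N" using assms quot_eq_iff[of x y] by simp
  have "y \<otimes> (x \<otimes> inv y) = (x \<otimes> inv y) \<otimes> y" by (rule N_comm[OF n assms(2), symmetric])
  also have "\<dots> = x" using assms(1,2) by (simp add: m_assoc)
  finally have "x = y \<otimes> (x \<otimes> inv y)" by (rule sym)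
  then show thesis by (rule that[OF n])
qed

lemma K_iff: "x \<in> K \<longleftrightarrow> (\<exists>y\<in>P. \<exists>n\<in>N. x = y \<otimes> n)"
proof
  assume x: "x \<in> K"
  then have "\<pi> x \<in> \<pi> ` P" using K_quot quot_P by simp
  then obtain y where y: "y \<in> P" "\<pi> x = \<pi> y" by blast
  obtain n where "n \<in> N" "x = y \<otimes> n"
    using mod_N_obtain[OF K_carrier[OF x] P.mem_carrier[OF y(1)] y(2)] .
  then show "\<exists>y\<in>P. \<exists>n\<in>N. x = y \<otimes> n" using y by blast
next
  assume "\<exists>y\<in>P. \<exists>n\<in>N. x = y \<otimes> n"
  then obtain y n where yn: "y \<in> P" "n \<in> N" "x = y \<otimes> n" by blast
  have "y \<otimes> n \<otimes> inv y = n" using conj_N[of n y] yn by (simp add: conj_def)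
  then have "\<pi> x = \<pi> y" using yn quot_eq_iff[of x y] by simp
  moreover have "\<pi> y \<in> V" using yn(1) quot_P by blast
  ultimately show "x \<in> K" using yn by (simp add: K_def)
qed

lemma P_in_K [simp]: "x \<in> P \<Longrightarrow> x \<in> K"
  using quot_P by (simp add: K_def) blast

lemma N_in_K [simp]: "x \<in> N \<Longrightarrow> x \<in> K"
  using Q.V.one_closed quot_eq_one_iff[of x] by (simp add: K_def)

sublocale K: normal K G
proof -
  have "subgroup K G"
  proof (rule subgroupI)
    show "K \<noteq> {}" using P_in_K[OF P.one_closed] by blast
    show "inv x \<in> K" if "x \<in> K" for x
      using that Q.V.m_inv_closed[of "\<pi> x"] by (simp add: K_def quot_inv)
    show "x \<otimes> y \<in> K" if "x \<in> K" "y \<in> K" for x y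
      using that Q.V.m_closed[of "\<pi> x" "\<pi> y"] by (simp add: K_def)
  qed (auto simp: K_def)
  moreover have "conj g x \<in> K" if "g \<in> carrier G" "x \<in> K" for g x
    using that Q.conj_V[of "\<pi> g" "\<pi> x"] by (simp add: K_def conj_quot quot_carrier)
  ultimately show "K \<lhd> G" unfolding normal_inv_iff by (simp add: conj_def)
qed

lemma conj_K [simp]: "\<lbrakk>g \<in> carrier G; x \<in> K\<rbrakk> \<Longrightarrow> conj g x \<in> K"
  using K.inv_op_closed2 by (simp add: conj_def)

text \<open>Commutators of \<open>P\<close> vanish in the abelian group \<open>V\<close>, so they
  lie in \<open>N\<close>, which \<open>P\<close> meets trivially.\<close>

lemma P_comm:
  assumes "x \<in> P" "y \<in> P"
  shows "x \<otimes> y = y \<otimes> x"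
proof -
  have "\<pi> x <#> \<pi> y = \<pi> y <#> \<pi> x"
    using Q.V_comm[of "\<pi> x" "\<pi> y"] assms quot_P by auto
  then have "\<pi> (x \<otimes> y) = \<pi> (y \<otimes> x)" using assms by simp
  then have "x \<otimes> y \<otimes> inv (y \<otimes> x) \<in> N" using assms by (subst (asm) quot_eq_iff) auto
  then have "x \<otimes> y \<otimes> inv (y \<otimes> x) = \<one>" using assms P_inter_N[of "x \<otimes> y \<otimes> inv (y \<otimes> x)"] by simp
  then show ?thesis using assms inv_equality[of "x \<otimes> y" "inv (y \<otimes> x)"] by simp
qed

lemma P_elementary: "elementary_abelian_p_subgroup G p P"
proof -
  have "x [^] p = \<one>" if x: "x \<in> P" for x
  proof -
    have "\<pi> x \<in> V" using x quot_P by blast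
    then have "\<pi> (x [^] p) = N" using Q.V_exponent[OF p, of "\<pi> x"] x by (simp add: quot_pow)
    then have "x [^] p \<in> N" using x by (simp add: quot_eq_one_iff)
    moreover have "x [^] n \<in> P" for n :: nat using x by (induction n) auto
    ultimately show ?thesis using P_inter_N by blast
  qed
  then show ?thesis using p(1) P P_comm by (simp add: elementary_abelian_p_subgroup_def)
qed

lemma K_comm:
  assumes "x \<in> K" "y \<in> K"
  shows "x \<otimes> y = y \<otimes> x"
proof -
  obtain u m v n where *: "u \<in> P" "m \<in> N" "x = u \<otimes> m" "v \<in> P" "n \<in> N" "y = v \<otimes> n"
    using assms K_iff by metis
  have "x \<otimes> y = (u \<otimes> v) \<otimes> (m \<otimes> n)"
    using * N_comm[of m v] by (simp add: m_assoc) (simp flip: m_assoc)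
  also have "\<dots> = (v \<otimes> u) \<otimes> (n \<otimes> m)"
    using * P_comm[of u v] N_comm[of m n] by simp
  also have "\<dots> = y \<otimes> x"
    using * N_comm[of n u] by (simp add: m_assoc) (simp flip: m_assoc)
  finally show ?thesis .
qed

lemma conj_K_trivial: "\<lbrakk>x \<in> K; y \<in> K\<rbrakk> \<Longrightarrow> conj x y = y"
  using K_comm by (simp add: conj_eq_self_iff)

lemma P_mult_A:
  assumes "g \<in> carrier G"
  obtains x a where "x \<in> P" "a \<in> A" "g = x \<otimes> a"
proof -
  have "\<pi> g \<in> carrier (G Mod N)" using assms by (simp add: quot_carrier)
  then obtain v b where vb: "v \<in> V" "b \<in> B" "\<pi> g = v <#> b" using Q.V_mult_B by force
  obtain x where x: "x \<in> P" "v = \<pi> x" using vb(1) quot_P by blast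
  obtain a where a: "a \<in> A" "b = \<pi> a" using vb(2) by (auto simp: B_def)
  have "\<pi> g = \<pi> (x \<otimes> a)" using vb x a by simp
  then obtain n where "n \<in> N" "g = (x \<otimes> a) \<otimes> n" using mod_N_obtain[of g "x \<otimes> a"] assms x a by auto
  then show thesis using that[of x "a \<otimes> n"] x a by (simp add: m_assoc)
qed

lemma K_inter_A: "\<lbrakk>x \<in> K; x \<in> A\<rbrakk> \<Longrightarrow> x \<in> N"
proof -
  assume "x \<in> K" "x \<in> A"
  then have "\<pi> x \<in> V \<inter> B" using K_quot by (simp add: B_def)
  then show "x \<in> N" using Q.V_inter_B \<open>x \<in> K\<close> quot_eq_one_iff by auto
qed

text \<open>This is \<open>twist_surj\<close> for the quotient, lifted to \<open>P\<close>. The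
  central factor \<open>n\<close> appears because \<open>a\<close> need not normalize
  \<open>P\<close>.\<close>

lemma twist_P:
  assumes a: "a \<in> A" "a \<notin> N" and y: "y \<in> P"
  obtains x n where "x \<in> P" "n \<in> N" "y = inv x \<otimes> conj a x \<otimes> n"
proof -
  have b: "\<pi> a \<in> B" "\<pi> a \<noteq> \<one>\<^bsub>G Mod N\<^esub>" using a by (simp_all add: B_def quot_eq_one_iff)
  have car: "\<pi> a \<in> carrier (G Mod N)" using a by (simp add: quot_carrier)
  have yV: "\<pi> y \<in> V" using y quot_P by blast
  obtain v where v: "v \<in> V" "\<pi> y = inv\<^bsub>G Mod N\<^esub> v \<otimes>\<^bsub>G Mod N\<^esub> Q.conj (\<pi> a) v"
    using Q.twist_surj[OF b Q.V_subgroup subset_refl Q.conj_V[OF car] yV] by blast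
  obtain x where x: "x \<in> P" "v = \<pi> x" using v(1) quot_P by blast
  have "\<pi> y = \<pi> (inv x \<otimes> conj a x)" using v x a by (simp add: quot_inv conj_quot)
  then obtain n where "n \<in> N" "y = inv x \<otimes> conj a x \<otimes> n"
    using mod_N_obtain[of y "inv x \<otimes> conj a x"] y x a by auto
  then show thesis using that x by blast
qed

text \<open>If some \<open>a\<close> outside \<open>N\<close> normalized \<open>P\<close>, the
  factor \<open>n\<close> of \<open>twist_P\<close> would lie in \<open>P\<close> and vanish, so
  every element of \<open>P\<close> would have the form \<open>inv x \<otimes> conj a x\<close>.
  Conjugation by \<open>c\<close> in \<open>A\<close> replaces \<open>x\<close> by an element of
  \<open>P\<close> times a central one, and the central one cancels in this expression. So
  \<open>A\<close> would normalize \<open>P\<close>, and \<open>P\<close> would be normal.\<close>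

lemma normalizing_in_N:
  assumes a: "a \<in> A" and norm: "\<And>x. x \<in> P \<Longrightarrow> conj a x \<in> P"
  shows "a \<in> N"
proof (rule ccontr)
  assume nN: "a \<notin> N"
  have conj_A: "conj c y \<in> P" if c: "c \<in> A" and y: "y \<in> P" for c y
  proof -
    obtain x n where x: "x \<in> P" "n \<in> N" "y = inv x \<otimes> conj a x \<otimes> n" using twist_P[OF a nN y] .
    have "n = inv (inv x \<otimes> conj a x) \<otimes> y" using x a by (simp add: group_word_simps)
    also have "\<dots> \<in> P" using x y norm by simp
    finally have "n = \<one>" using x P_inter_N by blast
    then have y_eq: "y = inv x \<otimes> conj a x" using x a by simp
    have "conj c x \<in> K" using x c by simp
    then obtain z m where z: "z \<in> P" "m \<in> N" "conj c x = z \<otimes> m" using K_iff by blast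
    have "conj c (conj a x) = conj a (conj c x)" using a c x A_comm by (simp add: conj_conj)
    then have "conj c y = inv (z \<otimes> m) \<otimes> conj a (z \<otimes> m)"
      using a c x z(3) by (simp add: y_eq conj_mult conj_inv)
    also have "\<dots> = inv m \<otimes> (inv z \<otimes> conj a z) \<otimes> m"
      using z a by (simp add: conj_mult group_word_simps)
    also have "\<dots> = inv z \<otimes> conj a z"
      using N_comm[of "inv m" "inv z \<otimes> conj a z"] z a by (simp add: m_assoc)
    also have "\<dots> \<in> P" using z norm by simp
    finally show ?thesis .
  qed
  have "conj g y \<in> P" if g: "g \<in> carrier G" and y: "y \<in> P" for g y
  proof -
    obtain x c where xc: "x \<in> P" "c \<in> A" "g = x \<otimes> c" using P_mult_A[OF g] .
    then have "conj g y = conj x (conj c y)" using y by (simp add: conj_conj)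
    then show ?thesis using conj_A[OF xc(2) y] conj_K_trivial xc(1) by simp
  qed
  then show False using P_not_normal by blast
qed

text \<open>Write \<open>g = x \<otimes> a\<close>. The factor \<open>x\<close> acts trivially on
  the abelian group \<open>K\<close>, so \<open>g\<close> and \<open>a\<close> conjugate
  \<open>P\<close> in the same way, and \<open>normalizing_in_N\<close> applies to
  \<open>a\<close>.\<close>

lemma normalizer_P: "normalizer G P = K"
proof
  show "K \<subseteq> normalizer G P"
  proof
    fix x assume x: "x \<in> K"
    have "conj x ` P = (\<lambda>y. y) ` P" by (rule image_cong) (simp_all add: conj_K_trivial x)
    then show "x \<in> normalizer G P" using x by (simp add: mem_normalizer_iff P.subset)
  qed
  show "normalizer G P \<subseteq> K"
  proof
    fix g assume "g \<in> normalizer G P"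
    then have g: "g \<in> carrier G" "conj g ` P = P" by (simp_all add: mem_normalizer_iff P.subset)
    obtain x a where xa: "x \<in> P" "a \<in> A" "g = x \<otimes> a" using P_mult_A[OF g(1)] .
    have "conj a y \<in> P" if y: "y \<in> P" for y
    proof -
      have "conj g y = conj x (conj a y)" using xa y by (simp add: conj_conj)
      also have "\<dots> = conj a y" using xa y by (simp add: conj_K_trivial)
      finally have "conj g y = conj a y" .
      moreover have "conj g y \<in> P" using g(2) y by blast
      ultimately show ?thesis by simp
    qed
    then have "a \<in> N" using normalizing_in_N xa(2) by blast
    then show "g \<in> K" using xa by simp
  qed
qed

text \<open>The centralizer lies between the abelian group \<open>K\<close> and the normalizer of
  \<open>P\<close>, which is \<open>K\<close>.\<close>

lemma centraliser_P: "centraliser G (carrier G) P = K"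
proof
  show "K \<subseteq> centraliser G (carrier G) P"
    using K_comm[OF _ P_in_K] by (auto simp: centraliser_def)
  show "centraliser G (carrier G) P \<subseteq> K"
  proof
    fix g assume "g \<in> centraliser G (carrier G) P"
    then have g: "g \<in> carrier G" "\<And>y. y \<in> P \<Longrightarrow> conj g y = y"
      by (auto simp: centraliser_def conj_eq_self_iff)
    have "conj g ` P = (\<lambda>y. y) ` P" by (rule image_cong) (simp_all add: g(2))
    then show "g \<in> K"
      unfolding normalizer_P[symmetric] mem_normalizer_iff[OF P.subset] using g(1) by simp
  qed
qed

lemma P_mult_N: "P <#> N = K"
  unfolding set_mult_def using K_iff by blast

lemma direct_product_K: "inner_direct_product G P N K"
  unfolding inner_direct_product_def
proof (intro conjI ballI)
  show "P \<inter> N = {\<one>}" using P_inter_N P.one_closed N.one_closed by blast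
qed (use P N.subgroup_axioms K_comm P_mult_N in simp_all)

section \<open>Products of two point stabilizers\<close>

text \<open>With \<open>z = inv x \<otimes> conj b x \<otimes> n\<close> and
  \<open>conj a x = y \<otimes> m\<close> the central \<open>m\<close> cancels, and
  \<open>conj a z\<close> becomes \<open>inv y \<otimes> conj b y \<otimes> n\<close>. Expressing
  \<open>n\<close> through \<open>x\<close> and \<open>z\<close> and collecting terms in the abelian
  group \<open>K\<close> leaves an element of \<open>P\<close> times a conjugate by
  \<open>b\<close>.\<close>

lemma set_mult_conj_subset:
  assumes a: "a \<in> A" "a \<notin> N" and b: "b \<in> A" "b \<notin> N"
  shows "P <#> conj a ` P \<subseteq> P <#> conj b ` P"
proof
  fix w assume "w \<in> P <#> conj a ` P"
  then obtain u z where uz: "u \<in> P" "z \<in> P" "w = u \<otimes> conj a z" by (auto simp: set_mult_def)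
  obtain x n where x: "x \<in> P" "n \<in> N" "z = inv x \<otimes> conj b x \<otimes> n" using twist_P[OF b uz(2)] .
  have "conj a x \<in> K" using x a by simp
  then obtain y m where y: "y \<in> P" "m \<in> N" "conj a x = y \<otimes> m" using K_iff by blast
  have car [simp]: "a \<in> carrier G" "b \<in> carrier G" "x \<in> carrier G" "y \<in> carrier G" "z \<in> carrier G"
    "u \<in> carrier G" "n \<in> carrier G" "m \<in> carrier G"
    using a b x y uz by auto
  have "conj a z = inv (conj a x) \<otimes> conj a (conj b x) \<otimes> n"
    using x(2) by (simp add: x(3) conj_mult conj_inv)
  also have "conj a (conj b x) = conj b (conj a x)" using A_comm[of a b] a b by (simp add: conj_conj)
  also have "inv (conj a x) \<otimes> conj b (conj a x) = inv m \<otimes> (inv y \<otimes> conj b y) \<otimes> m"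
    using y(2) by (simp add: y(3) conj_mult group_word_simps)
  also have "\<dots> = inv y \<otimes> conj b y"
    using N_comm[of "inv m" "inv y \<otimes> conj b y"] y(2) by (simp add: m_assoc)
  also have "n = conj b (inv x) \<otimes> x \<otimes> z"
    by (simp add: x(3) conj_inv group_word_simps)
  also have "inv y \<otimes> conj b y \<otimes> (conj b (inv x) \<otimes> x \<otimes> z) = inv y \<otimes> (conj b (y \<otimes> inv x) \<otimes> (x \<otimes> z))"
    by (simp add: conj_mult m_assoc)
  also have "conj b (y \<otimes> inv x) \<otimes> (x \<otimes> z) = (x \<otimes> z) \<otimes> conj b (y \<otimes> inv x)"
    using x(1) y(1) uz(2) by (intro K_comm) simp_all
  finally have "w = (u \<otimes> (inv y \<otimes> (x \<otimes> z))) \<otimes> conj b (y \<otimes> inv x)"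
    by (simp add: uz(3) m_assoc)
  moreover have "u \<otimes> (inv y \<otimes> (x \<otimes> z)) \<in> P" "y \<otimes> inv x \<in> P" using uz x y by simp_all
  ultimately show "w \<in> P <#> conj b ` P" unfolding set_mult_def by blast
qed

lemma set_mult_conj_eq:
  assumes g: "g \<in> carrier G" "g \<notin> K" and h: "h \<in> carrier G" "h \<notin> K"
  shows "P <#> conj g ` P = P <#> conj h ` P"
proof -
  \<comment> \<open>The factor of \<open>g\<close> in \<open>P\<close> acts trivially on
    \<open>K\<close>, so only conjugates by elements of \<open>A\<close> outside \<open>N\<close>
    have to be compared.\<close>
  have reduce: "\<exists>a\<in>A. a \<notin> N \<and> conj g ` P = conj a ` P" if g: "g \<in> carrier G" "g \<notin> K" for g
  proof -
    obtain x a where xa: "x \<in> P" "a \<in> A" "g = x \<otimes> a" using P_mult_A[OF g(1)] .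
    have "conj g ` P = conj a ` P"
    proof (rule image_cong)
      fix y assume "y \<in> P"
      then have "conj g y = conj x (conj a y)" using xa by (simp add: conj_conj)
      also have "\<dots> = conj a y" using xa \<open>y \<in> P\<close> by (simp add: conj_K_trivial)
      finally show "conj g y = conj a y" .
    qed simp
    moreover have "a \<notin> N" using g(2) xa by auto
    ultimately show ?thesis using xa(2) by blast
  qed
  obtain a b where "a \<in> A" "a \<notin> N" "conj g ` P = conj a ` P" "b \<in> A" "b \<notin> N" "conj h ` P = conj b ` P"
    using reduce[OF g] reduce[OF h] by blast
  then show ?thesis using set_mult_conj_subset[of a b] set_mult_conj_subset[of b a] by simp
qed

end

section \<open>Sylow subgroups and the action on the cosets\<close>

context abelian_maximal_complement begin

text \<open>\<open>p ^ m\<close> and \<open>r\<close> are the \<open>p\<close>-part and the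
  \<open>p'\<close>-part of |A|; the torsion subgroups \<open>A\<^sub>p\<close> and
  \<open>A\<^sub>r\<close> below become Q and S.\<close>

definition m where "m = multiplicity p (card A)"
definition r where "r = card A div p ^ m"
definition A\<^sub>p where "A\<^sub>p = {a \<in> A. a [^] (p ^ m) = \<one>}"
definition A\<^sub>r where "A\<^sub>r = {a \<in> A. a [^] r = \<one>}"

lemma card_A: "card A = p ^ m * r"
  unfolding m_def r_def by (simp add: multiplicity_dvd)

lemma not_dvd_r: "\<not> p dvd r"
proof
  assume "p dvd r"
  then have "p ^ Suc m dvd card A" by (subst card_A) (simp add: mult.commute mult_dvd_mono)
  moreover have "card A \<noteq> 0" using finite_A A.one_closed card_0_eq by blast
  ultimately have "Suc m \<le> m"
    unfolding m_def using p(1) by (intro multiplicity_geI) (auto simp: prime_nat_iff)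
  then show False by simp
qed

lemma coprime_r: "coprime (p ^ n) r"
  using prime_imp_coprime[OF p(1) not_dvd_r] by simp

lemma A_decomposition: "inner_direct_product G A\<^sub>p A\<^sub>r A" "card A\<^sub>p = p ^ m"
  using abelian_coprime_decomposition[OF A finite_A A_comm card_A coprime_r]
  by (simp_all add: A\<^sub>p_def A\<^sub>r_def)

lemma A\<^sub>p: "subgroup A\<^sub>p G" and A\<^sub>r: "subgroup A\<^sub>r G" and A\<^sub>p_inter_A\<^sub>r: "A\<^sub>p \<inter> A\<^sub>r = {\<one>}"
  and A\<^sub>p_mult_A\<^sub>r: "A\<^sub>p <#> A\<^sub>r = A"
  using A_decomposition(1) by (simp_all add: inner_direct_product_def)

sublocale A\<^sub>p: subgroup A\<^sub>p G by (rule A\<^sub>p)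

sublocale A\<^sub>r: subgroup A\<^sub>r G by (rule A\<^sub>r)

lemma A\<^sub>r_in_A: "x \<in> A\<^sub>r \<Longrightarrow> x \<in> A"
  and A\<^sub>r_pow: "x \<in> A\<^sub>r \<Longrightarrow> x [^] r = \<one>"
  unfolding A\<^sub>r_def by blast+

text \<open>In A/N the image of \<open>x\<close> is killed by \<open>p ^ m\<close> and by
  \<open>card B\<close>, which is prime to \<open>p\<close>.\<close>

lemma A\<^sub>p_in_N [simp]: "x \<in> A\<^sub>p \<Longrightarrow> x \<in> N"
proof -
  assume "x \<in> A\<^sub>p"
  then have x: "x \<in> A" "x [^] (p ^ m) = \<one>" by (simp_all add: A\<^sub>p_def)
  have \<pi>x: "\<pi> x \<in> B" "\<pi> x \<in> carrier (G Mod N)" using x(1) by (simp_all add: B_def quot_carrier)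
  have "\<pi> x [^]\<^bsub>G Mod N\<^esub> (p ^ m) = \<one>\<^bsub>G Mod N\<^esub>" using x by (simp add: quot_pow)
  moreover have "\<pi> x [^]\<^bsub>G Mod N\<^esub> card B = \<one>\<^bsub>G Mod N\<^esub>"
    using Q.GB.pow_order_eq_1[of "\<pi> x"] \<pi>x(1)
    by (simp add: order_def Q.nat_pow_consistent[symmetric])
  moreover have "coprime (p ^ m) (card B)"
    using prime_imp_coprime[OF p(1) Q.prime_not_dvd_card_B[OF p]] by simp
  ultimately have "\<pi> x = \<one>\<^bsub>G Mod N\<^esub>" using Q.pow_eq_one_coprime[OF \<pi>x(2)] by blast
  then show "x \<in> N" using x(1) by (simp add: quot_eq_one_iff)
qed

text \<open>The centralizer of \<open>P\<close> is \<open>K\<close>, and \<open>K\<close> meets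
  \<open>A\<close> in \<open>N\<close>, so the second factor is the intersection of
  \<open>A\<^sub>r\<close> and \<open>N\<close>. Since \<open>A\<^sub>p\<close> lies in
  \<open>N\<close>, the decomposition of \<open>A\<close> restricts to \<open>N\<close>.\<close>

lemma N_decomposition: "inner_direct_product G A\<^sub>p (centraliser G A\<^sub>r P) N"
proof -
  have cent: "centraliser G A\<^sub>r P = A\<^sub>r \<inter> N"
  proof
    show "centraliser G A\<^sub>r P \<subseteq> A\<^sub>r \<inter> N"
    proof
      fix x assume x: "x \<in> centraliser G A\<^sub>r P"
      then have "x \<in> centraliser G (carrier G) P" by (simp add: centraliser_def)
      then have "x \<in> K" by (simp add: centraliser_P)
      moreover have "x \<in> A\<^sub>r" using x by (simp add: centraliser_def)
      ultimately show "x \<in> A\<^sub>r \<inter> N" using K_inter_A A\<^sub>r_in_A by blast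
    qed
    show "A\<^sub>r \<inter> N \<subseteq> centraliser G A\<^sub>r P"
      by (auto simp: centraliser_def intro: N_comm)
  qed
  have "A\<^sub>p <#> (A\<^sub>r \<inter> N) = N"
  proof
    show "A\<^sub>p <#> (A\<^sub>r \<inter> N) \<subseteq> N" by (auto simp: set_mult_def)
    show "N \<subseteq> A\<^sub>p <#> (A\<^sub>r \<inter> N)"
    proof
      fix n assume n: "n \<in> N"
      then have "n \<in> A\<^sub>p <#> A\<^sub>r" using A\<^sub>p_mult_A\<^sub>r by simp
      then obtain q s where qs: "q \<in> A\<^sub>p" "s \<in> A\<^sub>r" "n = q \<otimes> s" unfolding set_mult_def by blast
      have "s = inv q \<otimes> n" unfolding qs(3) using qs(1,2) by (simp add: group_word_simps)
      then have "s \<in> N" using n qs(1) by simp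
      then show "n \<in> A\<^sub>p <#> (A\<^sub>r \<inter> N)" using qs unfolding set_mult_def by blast
    qed
  qed
  moreover have "A\<^sub>p \<inter> (A\<^sub>r \<inter> N) = {\<one>}" using A\<^sub>p_inter_A\<^sub>r N.one_closed by blast
  moreover have "subgroup (A\<^sub>r \<inter> N) G" using A\<^sub>r N.subgroup_axioms by (rule subgroups_Inter_pair)
  ultimately show ?thesis
    unfolding inner_direct_product_def cent
  proof (intro conjI ballI)
    show "h \<otimes> k = k \<otimes> h" if "h \<in> A\<^sub>p" "k \<in> A\<^sub>r \<inter> N" for h k
      using that by (intro N_comm) simp_all
  qed (simp_all add: A\<^sub>p)
qed

section \<open>The normal Sylow subgroup and its complement\<close>

definition T where "T = P <#> A\<^sub>p"

text \<open>\<open>P\<close> is killed by \<open>p\<close> and \<open>A\<^sub>p\<close> by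
  \<open>p ^ m\<close>. The exponent \<open>Suc m\<close> serves both, also for
  \<open>m = 0\<close>, a case that only \<open>A\<^sub>p_nontrivial\<close> excludes.\<close>

lemma P_pow: "x \<in> P \<Longrightarrow> x [^] (p ^ Suc m) = \<one>"
  and A\<^sub>p_pow: "x \<in> A\<^sub>p \<Longrightarrow> x [^] (p ^ Suc m) = \<one>"
proof -
  assume x: "x \<in> P"
  then have "x [^] p = \<one>" using P_elementary by (simp add: elementary_abelian_p_subgroup_def)
  then have "(x [^] p) [^] (p ^ m) = \<one>" by simp
  then show "x [^] (p ^ Suc m) = \<one>" using nat_pow_pow[of x p "p ^ m"] x by simp
next
  assume x: "x \<in> A\<^sub>p"
  then have "x [^] (p ^ m) = \<one>" unfolding A\<^sub>p_def by blast
  then have "(x [^] (p ^ m)) [^] p = \<one>" by simp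
  then show "x [^] (p ^ Suc m) = \<one>" using nat_pow_pow[of x "p ^ m" p] x by (simp add: mult.commute)
qed

lemma A_obtain:
  assumes "a \<in> A"
  obtains q s where "q \<in> A\<^sub>p" "s \<in> A\<^sub>r" "a = q \<otimes> s"
proof -
  have "a \<in> A\<^sub>p <#> A\<^sub>r" using A\<^sub>p_mult_A\<^sub>r assms by simp
  then show thesis using that unfolding set_mult_def by blast
qed

lemma T_I: "\<lbrakk>y \<in> P; q \<in> A\<^sub>p\<rbrakk> \<Longrightarrow> y \<otimes> q \<in> T"
  unfolding T_def set_mult_def by blast

text \<open>This describes \<open>T\<close> as the \<open>p\<close>-torsion of the abelian normal
  subgroup \<open>K\<close>, a description invariant under conjugation. For the converse write an
  element of \<open>K\<close> as \<open>y \<otimes> q \<otimes> s\<close>: the power kills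
  \<open>y\<close> and \<open>q\<close>, hence also \<open>s\<close>, which \<open>r\<close> kills
  too.\<close>

lemma T_iff: "x \<in> T \<longleftrightarrow> x \<in> K \<and> x [^] (p ^ Suc m) = \<one>"
proof
  assume "x \<in> T"
  then obtain y q where yq: "y \<in> P" "q \<in> A\<^sub>p" "x = y \<otimes> q" unfolding T_def set_mult_def by blast
  have "x [^] (p ^ Suc m) = y [^] (p ^ Suc m) \<otimes> q [^] (p ^ Suc m)"
    unfolding yq(3) by (rule pow_mult_distrib[OF K_comm]) (use yq in simp_all)
  moreover have "x \<in> K" unfolding yq(3) using yq by simp
  ultimately show "x \<in> K \<and> x [^] (p ^ Suc m) = \<one>" unfolding P_pow[OF yq(1)] A\<^sub>p_pow[OF yq(2)] by simp
next
  assume x: "x \<in> K \<and> x [^] (p ^ Suc m) = \<one>"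
  then obtain y n where yn: "y \<in> P" "n \<in> N" "x = y \<otimes> n" using K_iff by blast
  obtain q s where qs: "q \<in> A\<^sub>p" "s \<in> A\<^sub>r" "n = q \<otimes> s" using A_obtain[OF N_in_A[OF yn(2)]] .
  have x_eq: "x = (y \<otimes> q) \<otimes> s" unfolding yn(3) qs(3) using yn(1) qs(1,2) by (simp add: m_assoc)
  have "s = inv q \<otimes> n" unfolding qs(3) using qs(1,2) by (simp add: group_word_simps)
  then have sN: "s \<in> N" using yn(2) qs(1) by simp
  have "x [^] (p ^ Suc m) = (y \<otimes> q) [^] (p ^ Suc m) \<otimes> s [^] (p ^ Suc m)"
    unfolding x_eq by (rule pow_mult_distrib[OF K_comm]) (use yn(1) qs(1) sN in simp_all)
  also have "(y \<otimes> q) [^] (p ^ Suc m) = y [^] (p ^ Suc m) \<otimes> q [^] (p ^ Suc m)"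
    by (rule pow_mult_distrib[OF K_comm]) (use yn(1) qs(1) in simp_all)
  finally have "s [^] (p ^ Suc m) = \<one>"
    unfolding P_pow[OF yn(1)] A\<^sub>p_pow[OF qs(1)] using x A\<^sub>r.mem_carrier[OF qs(2)] by simp
  moreover have "s [^] r = \<one>" using A\<^sub>r_pow[OF qs(2)] .
  ultimately have "s = \<one>"
    by (rule pow_eq_one_coprime[OF A\<^sub>r.mem_carrier[OF qs(2)] _ _ coprime_r])
  then show "x \<in> T" using T_I[OF yn(1) qs(1)] yn(1) qs(1) unfolding x_eq by simp
qed

lemma T_in_K: "x \<in> T \<Longrightarrow> x \<in> K"
  using T_iff by blast

lemma conj_T: "\<lbrakk>g \<in> carrier G; x \<in> T\<rbrakk> \<Longrightarrow> conj g x \<in> T"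
  unfolding T_iff using conj_pow[of g x "p ^ Suc m"] by simp

sublocale T: normal T G
proof -
  have "subgroup T G"
  proof (rule subgroupI)
    have "\<one> \<in> T" unfolding T_iff by simp
    then show "T \<noteq> {}" by blast
    show "inv x \<in> T" if "x \<in> T" for x
      using that unfolding T_iff by (simp add: nat_pow_inv)
    show "x \<otimes> y \<in> T" if "x \<in> T" "y \<in> T" for x y
    proof -
      have xy: "x \<in> K" "y \<in> K" "x [^] (p ^ Suc m) = \<one>" "y [^] (p ^ Suc m) = \<one>"
        using that T_iff by blast+
      have "(x \<otimes> y) [^] (p ^ Suc m) = x [^] (p ^ Suc m) \<otimes> y [^] (p ^ Suc m)"
        by (rule pow_mult_distrib[OF K_comm]) (use xy in simp_all)
      then show ?thesis unfolding T_iff xy(3,4) using xy(1,2) by simp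
    qed
  qed (use T_in_K K_carrier in blast)
  then show "T \<lhd> G" unfolding normal_inv_iff using conj_T by (simp add: conj_def)
qed

lemma T_inter_A\<^sub>r: "T \<inter> A\<^sub>r = {\<one>}"
proof -
  have "x = \<one>" if x: "x \<in> T" "x \<in> A\<^sub>r" for x
  proof -
    have "x [^] (p ^ Suc m) = \<one>" using x(1) T_iff by blast
    then show ?thesis
      using pow_eq_one_coprime[OF A\<^sub>r.mem_carrier[OF x(2)] _ A\<^sub>r_pow[OF x(2)] coprime_r] by blast
  qed
  then show ?thesis using T.one_closed A\<^sub>r.one_closed by blast
qed

lemma T_mult_A\<^sub>r: "T <#> A\<^sub>r = carrier G"
proof
  show "T <#> A\<^sub>r \<subseteq> carrier G" by (rule set_mult_closed[OF T.subset A\<^sub>r.subset])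
  show "carrier G \<subseteq> T <#> A\<^sub>r"
  proof
    fix g assume g: "g \<in> carrier G"
    obtain x a where xa: "x \<in> P" "a \<in> A" "g = x \<otimes> a" using P_mult_A[OF g] .
    obtain q s where qs: "q \<in> A\<^sub>p" "s \<in> A\<^sub>r" "a = q \<otimes> s" using A_obtain[OF xa(2)] .
    have "g = (x \<otimes> q) \<otimes> s" unfolding xa(3) qs(3) using xa(1) qs(1,2) by (simp add: m_assoc)
    moreover have "x \<otimes> q \<in> T" using xa(1) qs(1) by (rule T_I)
    ultimately show "g \<in> T <#> A\<^sub>r" using qs(2) unfolding set_mult_def by blast
  qed
qed

lemma P_inter_A\<^sub>p: "P \<inter> A\<^sub>p = {\<one>}"
  using P_inter_N A\<^sub>p_in_N P.one_closed A\<^sub>p.one_closed by blast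

lemma T_direct: "inner_direct_product G P A\<^sub>p T"
  unfolding inner_direct_product_def
proof (intro conjI ballI)
  show "x \<otimes> y = y \<otimes> x" if "x \<in> P" "y \<in> A\<^sub>p" for x y
    using that by (intro K_comm) simp_all
qed (simp_all add: P A\<^sub>p P_inter_A\<^sub>p T_def)

lemma G_semidirect: "inner_semidirect_product G T A\<^sub>r (carrier G)"
  unfolding inner_semidirect_product_def
proof (intro conjI ballI)
  show "x \<otimes> h \<otimes> inv x \<in> T" if "x \<in> carrier G" "h \<in> T" for x h
    using that by (rule T.inv_op_closed2)
qed (rule T.subgroup_axioms A\<^sub>r T_inter_A\<^sub>r T_mult_A\<^sub>r)+

lemma card_T: "card T = p ^ multiplicity p (order G)"
proof -
  obtain k where k: "card P = p ^ k" using Q.card_V_prime_power[OF p] card_V by auto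
  have "card T = p ^ (k + m)"
    using card_set_mult_disjoint[OF P A\<^sub>p P_inter_A\<^sub>p] A_decomposition(2) k by (simp add: T_def power_add)
  moreover have "order G = p ^ (k + m) * r" using card_P card_A k by (simp add: power_add)
  moreover have "multiplicity p (p ^ (k + m) * r) = k + m"
    using p(1) not_dvd_r multiplicity_prime_elem_times_other[of p r]
    by (intro multiplicity_decomposeI[of _ _ _ r]) (auto simp: prime_nat_iff)
  ultimately show ?thesis by simp
qed

lemma sylow_T: "sylow_subgroup G p T"
  using T.subgroup_axioms card_T by (simp add: sylow_subgroup_def)

text \<open>\<open>T\<close> is normal with complement \<open>A\<^sub>r\<close>. For
  \<open>x = t \<otimes> s\<close> of \<open>p\<close>-power order the same power of
  \<open>s\<close> lies in \<open>T\<close> and in \<open>A\<^sub>r\<close>, so it is trivial; as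
  \<open>r\<close> kills \<open>s\<close> as well, \<open>s\<close> is trivial.\<close>

lemma sylow_unique:
  assumes "sylow_subgroup G p R"
  shows "R = T"
proof -
  let ?e = "p ^ multiplicity p (order G)"
  have R: "subgroup R G" "card R = ?e" using assms by (simp_all add: sylow_subgroup_def)
  interpret RG: group "G\<lparr>carrier := R\<rparr>" using R(1) by (rule subgroup_imp_group)
  have "x \<in> T" if x: "x \<in> R" for x
  proof -
    have xG: "x \<in> carrier G" using subgroup.mem_carrier[OF R(1) x] .
    have x_pow: "x [^] ?e = \<one>"
      using RG.pow_order_eq_1[of x] x R(2) by (simp add: order_def flip: nat_pow_consistent)
    have "x \<in> T <#> A\<^sub>r" using xG T_mult_A\<^sub>r by simp
    then obtain t s where ts: "t \<in> T" "s \<in> A\<^sub>r" "x = t \<otimes> s" unfolding set_mult_def by blast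
    have sG: "s \<in> carrier G" using ts(2) by simp
    have "inv (s [^] ?e) \<in> T"
      using T.mult_pow_mod[OF ts(1) sG, of ?e] x_pow sG by (simp flip: ts(3))
    then have "s [^] ?e \<in> T" using T.m_inv_closed[of "inv (s [^] ?e)"] sG by simp
    moreover have "s [^] n \<in> A\<^sub>r" for n :: nat using ts(2) by (induction n) auto
    ultimately have "s [^] ?e = \<one>" using T_inter_A\<^sub>r by blast
    moreover have "s [^] r = \<one>" using A\<^sub>r_pow[OF ts(2)] .
    ultimately have "s = \<one>" using pow_eq_one_coprime[OF sG _ _ coprime_r] by blast
    then show "x \<in> T" using ts by simp
  qed
  moreover have "finite T" using fin T.subset finite_subset by blast
  ultimately show ?thesis using R(2) card_T by (intro card_subset_eq) auto
qed

lemma A\<^sub>p_nontrivial: "A\<^sub>p \<noteq> {\<one>}"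
proof
  assume "A\<^sub>p = {\<one>}"
  then have "T = P" by (auto simp: T_def set_mult_def)
  then show False using P_not_normal conj_T by auto
qed

text \<open>Otherwise \<open>A = A\<^sub>p\<close> would be contained in \<open>N\<close>, and
  \<open>B\<close> would be trivial.\<close>

lemma A\<^sub>r_nontrivial: "A\<^sub>r \<noteq> {\<one>}"
proof
  assume "A\<^sub>r = {\<one>}"
  then have "A = A\<^sub>p" using A\<^sub>p_mult_A\<^sub>r by (auto simp: set_mult_def)
  then have "A \<subseteq> N" using A\<^sub>p_in_N by blast
  then have "\<pi> a = N" if "a \<in> A" for a
    using that by (subst quot_eq_one_iff) auto
  then have "B \<subseteq> {\<one>\<^bsub>G Mod N\<^esub>}" unfolding B_def one_FactGroup by blast
  then show False using Q.B_nontrivial Q.B.one_closed by blast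
qed

section \<open>The affine primitive action on the cosets\<close>

lemma quot_K: "\<pi> ` (P <#> N) = V"
proof
  show "\<pi> ` (P <#> N) \<subseteq> V" unfolding P_mult_N using K_quot by blast
  show "V \<subseteq> \<pi> ` (P <#> N)" unfolding P_mult_N quot_P[symmetric] using P_in_K by blast
qed

lemma quot_semidirect:
  "inner_semidirect_product (G Mod N) (\<pi> ` (P <#> N)) (\<pi> ` A) (carrier (G Mod N))"
  unfolding inner_semidirect_product_def quot_K B_def[symmetric]
proof (intro conjI ballI)
  show "V <#>\<^bsub>G Mod N\<^esub> B = carrier (G Mod N)"
  proof
    show "V <#>\<^bsub>G Mod N\<^esub> B \<subseteq> carrier (G Mod N)"
      by (rule Q.set_mult_closed[OF Q.V.subset Q.B.subset])
    show "carrier (G Mod N) \<subseteq> V <#>\<^bsub>G Mod N\<^esub> B"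
      using Q.V_mult_B unfolding set_mult_def by blast
  qed
  show "x \<otimes>\<^bsub>G Mod N\<^esub> h \<otimes>\<^bsub>G Mod N\<^esub> inv\<^bsub>G Mod N\<^esub> x \<in> V" if "x \<in> carrier (G Mod N)" "h \<in> V" for x h
    using that by (rule Q.V.inv_op_closed2)
qed (rule Q.V_subgroup Q.B Q.V_inter_B)+

text \<open>\<open>N\<close> is central and contained in \<open>A\<close>, so the coset absorbs it.
  Hence setwise multiplication gives the action of the quotient.\<close>

lemma coset_action:
  assumes h: "h \<in> carrier G" and g: "g \<in> carrier G"
  shows "(A #> h) <#> \<pi> g = A #> (h \<otimes> g)"
proof
  show "(A #> h) <#> \<pi> g \<subseteq> A #> (h \<otimes> g)"
  proof
    fix x assume "x \<in> (A #> h) <#> \<pi> g"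
    then obtain a n where an: "a \<in> A" "n \<in> N" "x = (a \<otimes> h) \<otimes> (n \<otimes> g)"
      unfolding set_mult_def r_coset_def by blast
    have "(a \<otimes> h) \<otimes> (n \<otimes> g) = a \<otimes> (h \<otimes> n) \<otimes> g" using an(1,2) g h by (simp add: m_assoc)
    also have "\<dots> = (a \<otimes> n) \<otimes> (h \<otimes> g)"
      unfolding N_comm[OF an(2) h, symmetric] using an(1,2) g h by (simp add: m_assoc)
    finally have "x = (a \<otimes> n) \<otimes> (h \<otimes> g)" unfolding an(3) .
    moreover have "a \<otimes> n \<in> A" using an(1,2) by simp
    ultimately show "x \<in> A #> (h \<otimes> g)" unfolding r_coset_def by blast
  qed
  show "A #> (h \<otimes> g) \<subseteq> (A #> h) <#> \<pi> g"
  proof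
    fix x assume "x \<in> A #> (h \<otimes> g)"
    then obtain a where a: "a \<in> A" "x = a \<otimes> (h \<otimes> g)" unfolding r_coset_def by blast
    have "x = (a \<otimes> h) \<otimes> (\<one> \<otimes> g)" unfolding a(2) using a(1) g h by (simp add: m_assoc)
    then show "x \<in> (A #> h) <#> \<pi> g" unfolding set_mult_def r_coset_def using a(1) N.one_closed by blast
  qed
qed

lemma A_cosets: "Z \<in> rcosets A \<longleftrightarrow> (\<exists>h\<in>carrier G. Z = A #> h)"
  unfolding RCOSETS_def by blast

lemma quot_elements: "C \<in> carrier (G Mod N) \<longleftrightarrow> (\<exists>g\<in>carrier G. C = \<pi> g)"
  unfolding quot_carrier by blast

lemma coset_right_action: "right_action (G Mod N) (rcosets A) (\<lambda>C Z. Z <#> C)"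
  unfolding right_action_def
proof (intro conjI ballI)
  fix C Z assume "C \<in> carrier (G Mod N)" "Z \<in> rcosets A"
  then obtain g h where "g \<in> carrier G" "C = \<pi> g" "h \<in> carrier G" "Z = A #> h"
    unfolding A_cosets quot_elements by blast
  then show "Z <#> C \<in> rcosets A" using coset_action[of h g] A_cosets by auto
next
  fix Z assume "Z \<in> rcosets A"
  then obtain h where h: "h \<in> carrier G" "Z = A #> h" unfolding A_cosets by blast
  have "\<pi> \<one> = N" by (rule coset_mult_one[OF N.subset])
  then show "Z <#> \<one>\<^bsub>G Mod N\<^esub> = Z" using coset_action[OF h(1) one_closed] h by simp
next
  fix C D Z assume "C \<in> carrier (G Mod N)" "D \<in> carrier (G Mod N)" "Z \<in> rcosets A"
  then obtain g g' h where *: "g \<in> carrier G" "C = \<pi> g" "g' \<in> carrier G" "D = \<pi> g'" "h \<in> carrier G" "Z = A #> h"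
    unfolding A_cosets quot_elements by blast
  show "Z <#> (C \<otimes>\<^bsub>G Mod N\<^esub> D) = Z <#> C <#> D"
    using *(1,3,5) unfolding *(2,4,6) by (simp add: coset_action m_assoc)
qed

text \<open>An element that fixes all cosets has all its conjugates in \<open>A\<close>; comparing
  it with its conjugate by one \<open>h\<close> outside \<open>A\<close> puts it into
  \<open>N\<close>.\<close>

lemma coset_faithful: "faithful_action (G Mod N) (rcosets A) (\<lambda>C Z. Z <#> C)"
  unfolding faithful_action_def
proof (intro conjI ballI impI)
  show "right_action (G Mod N) (rcosets A) (\<lambda>C Z. Z <#> C)" by (rule coset_right_action)
  fix C assume "C \<in> carrier (G Mod N)" and fixes_all: "\<forall>Z\<in>rcosets A. Z <#> C = Z"
  then obtain g where g: "g \<in> carrier G" "C = \<pi> g" unfolding quot_elements by blast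
  have conj_g: "conj h g \<in> A" if h: "h \<in> carrier G" for h
  proof -
    have "A #> h \<in> rcosets A" using h unfolding A_cosets by blast
    then have "A #> (h \<otimes> g) = A #> h" using fixes_all h g coset_action[of h g] by simp
    then show ?thesis using rcos_eq_iff[OF A, of "h \<otimes> g" h] h g by (simp add: conj_def)
  qed
  obtain h where h: "h \<in> carrier G" "h \<notin> A" using A_proper A.subset by blast
  have "g \<in> A" using conj_g[OF one_closed] g(1) by simp
  then have "g \<in> N" using A_malnormal[OF h] conj_g[OF h(1)] by blast
  then show "C = \<one>\<^bsub>G Mod N\<^esub>" using g quot_eq_one_iff[of g] by simp
qed

text \<open>The stabilizer of a block through \<open>A #> h\<close> contains the stabilizer of this
  coset, a conjugate of the maximal subgroup \<open>A\<close>. It is that conjugate, and the block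
  is a point, or it is everything.\<close>

lemma coset_primitive: "primitive_action (G Mod N) (rcosets A) (\<lambda>C Z. Z <#> C)"
  unfolding primitive_action_def
proof (intro conjI ballI allI impI)
  show "right_action (G Mod N) (rcosets A) (\<lambda>C Z. Z <#> C)" by (rule coset_right_action)
next
  fix Y Z assume "Y \<in> rcosets A" "Z \<in> rcosets A"
  then obtain h k where *: "h \<in> carrier G" "Y = A #> h" "k \<in> carrier G" "Z = A #> k"
    unfolding A_cosets by blast
  have "Y <#> \<pi> (inv h \<otimes> k) = Z"
    using * coset_action[of h "inv h \<otimes> k"] by (simp add: group_word_simps)
  then show "\<exists>C\<in>carrier (G Mod N). Y <#> C = Z" using * unfolding quot_carrier by blast
next
  fix D assume D: "D \<subseteq> rcosets A \<and> D \<noteq> {} \<and>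
    (\<forall>C\<in>carrier (G Mod N). (\<lambda>Z. Z <#> C) ` D = D \<or> (\<lambda>Z. Z <#> C) ` D \<inter> D = {})"
  then obtain Z where "Z \<in> D" "Z \<in> rcosets A" by blast
  then obtain h where h: "h \<in> carrier G" "A #> h \<in> D" unfolding A_cosets by blast
  have D_coset: thesis
    if "Y \<in> D" and "\<And>k. \<lbrakk>k \<in> carrier G; Y = A #> k\<rbrakk> \<Longrightarrow> thesis" for Y thesis
  proof -
    have "Y \<in> rcosets A" using D \<open>Y \<in> D\<close> by blast
    then show thesis using that(2) unfolding A_cosets by blast
  qed
  \<comment> \<open>Acting by \<open>conj (inv h) x\<close> instead of \<open>x\<close> replaces the
    stabilizer of \<open>A #> h\<close> by \<open>A\<close> itself.\<close>
  define act where "act x = (\<lambda>Z. Z <#> \<pi> (conj (inv h) x)) ` D" for x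
  \<comment> \<open>A block is mapped onto itself as soon as one of its elements stays inside
    it.\<close>
  have block: "act x = D" if x: "x \<in> carrier G" "A #> k \<in> D" "k \<in> carrier G" "A #> (k \<otimes> conj (inv h) x) \<in> D" for x k
  proof -
    have "A #> (k \<otimes> conj (inv h) x) \<in> act x"
      using coset_action[of k "conj (inv h) x"] x h(1) unfolding act_def by force
    moreover have "\<pi> (conj (inv h) x) \<in> carrier (G Mod N)" using x h unfolding quot_carrier by blast
    ultimately show ?thesis using D x(4) unfolding act_def by blast
  qed
  have act_mult: "act (x \<otimes> y) = (\<lambda>Z. Z <#> \<pi> (conj (inv h) y)) ` act x"
    if xy: "x \<in> carrier G" "y \<in> carrier G" for x y
    unfolding act_def image_image
  proof (rule image_cong)
    fix Z assume "Z \<in> D"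
    then obtain k where k: "k \<in> carrier G" "Z = A #> k" by (rule D_coset)
    show "Z <#> \<pi> (conj (inv h) (x \<otimes> y)) = Z <#> \<pi> (conj (inv h) x) <#> \<pi> (conj (inv h) y)"
      unfolding k(2) using k(1) h(1) xy
      by (simp add: coset_action conj_mult m_assoc del: quot_mult)
  qed simp
  define L where "L = {x \<in> carrier G. act x = D}"
  have act_one: "act \<one> = D"
    using block[of \<one> h] h by simp
  have "subgroup L G"
  proof (rule subgroupI)
    show "L \<subseteq> carrier G" unfolding L_def by blast
    show "L \<noteq> {}" using act_one unfolding L_def by blast
    show "x \<otimes> y \<in> L" if "x \<in> L" "y \<in> L" for x y
    proof -
      have xy: "x \<in> carrier G" "y \<in> carrier G" "act x = D" "act y = D" using that unfolding L_def by blast+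
      then show ?thesis using act_mult[OF xy(1,2)] unfolding L_def act_def[of y] by simp
    qed
    show "inv x \<in> L" if "x \<in> L" for x
    proof -
      have x: "x \<in> carrier G" "act x = D" using that unfolding L_def by blast+
      have "act (x \<otimes> inv x) = act (inv x)"
        using act_mult[OF x(1) inv_closed[OF x(1)]] unfolding x(2) act_def[of "inv x"] .
      then show ?thesis using act_one x(1) unfolding L_def by simp
    qed
  qed
  moreover have "A \<subseteq> L"
  proof
    fix a assume a: "a \<in> A"
    have "h \<otimes> conj (inv h) a = a \<otimes> h" using a h(1) by (simp add: conj_def group_word_simps)
    moreover have "A #> (a \<otimes> h) = A #> h"
      using rcos_eq_iff[OF A, of "a \<otimes> h" h] a h(1) by (simp add: m_assoc)
    ultimately show "a \<in> L" using block[of a h] a h unfolding L_def by simp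
  qed
  ultimately consider "L = A" | "L = carrier G" using A_max by blast
  then show "card D = 1 \<or> D = rcosets A"
  proof cases
    case 1
    have "Z = A #> h" if Z: "Z \<in> D" for Z
    proof -
      obtain k where k: "k \<in> carrier G" "Z = A #> k" using Z by (rule D_coset)
      define x where "x = k \<otimes> inv h"
      have x: "x \<in> carrier G" "h \<otimes> conj (inv h) x = k" using h(1) k(1)
        by (simp_all add: x_def conj_def group_word_simps)
      have "x \<in> L" using block[OF x(1) h(2,1)] Z k x unfolding L_def by simp
      then have "x \<in> A" using 1 by simp
      then show ?thesis using rcos_eq_iff[OF A k(1) h(1)] k(2) by (simp add: x_def)
    qed
    then have "D = {A #> h}" using h(2) by blast
    then show ?thesis by simp
  next
    case 2
    have "Z \<in> D" if "Z \<in> rcosets A" for Z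
    proof -
      obtain k where k: "k \<in> carrier G" "Z = A #> k" using \<open>Z \<in> rcosets A\<close> unfolding A_cosets by blast
      define x where "x = k \<otimes> inv h"
      have x: "x \<in> carrier G" "h \<otimes> conj (inv h) x = k" using h(1) k(1)
        by (simp_all add: x_def conj_def group_word_simps)
      have "act x = D" using 2 x(1) unfolding L_def by blast
      moreover have "A #> h <#> \<pi> (conj (inv h) x) = Z" using coset_action[of h "conj (inv h) x"] x h(1) k by simp
      ultimately show ?thesis using h(2) unfolding act_def by blast
    qed
    then show ?thesis using D by blast
  qed
qed

lemma V_elementary: "elementary_abelian_p_subgroup (G Mod N) p V"
  unfolding elementary_abelian_p_subgroup_def
  using p(1) Q.V_subgroup Q.V_comm Q.V_exponent[OF p] by blast

lemma coset_affine: "affine_primitive_action (G Mod N) (rcosets A) (\<lambda>C Z. Z <#> C)"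
proof -
  have regular: "\<exists>!v. v \<in> V \<and> Y <#> v = Z" if YZ: "Y \<in> rcosets A" "Z \<in> rcosets A" for Y Z
  proof -
    obtain h k where hk: "h \<in> carrier G" "Y = A #> h" "k \<in> carrier G" "Z = A #> k"
      using YZ unfolding A_cosets by blast
    \<comment> \<open>Decomposing the inverse gives \<open>k \<otimes> inv h\<close> with its factor
      from \<open>A\<close> on the left, where the coset absorbs it.\<close>
    obtain x a where xa: "x \<in> P" "a \<in> A" "inv (k \<otimes> inv h) = x \<otimes> a"
      using P_mult_A[of "inv (k \<otimes> inv h)"] hk by blast
    have kh: "k \<otimes> inv h = inv a \<otimes> inv x"
    proof -
      have "k \<otimes> inv h = inv (inv (k \<otimes> inv h))" using hk by simp
      then show ?thesis unfolding xa(3) using xa(1,2) by (simp add: inv_mult_group)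
    qed
    \<comment> \<open>The remaining factor is moved to the right of \<open>h\<close>, where the
      acting element belongs; normality keeps it in \<open>K\<close>.\<close>
    define u where "u = conj (inv h) (inv x)"
    have u: "u \<in> K" "h \<otimes> u = inv x \<otimes> h"
    proof -
      show "u \<in> K" unfolding u_def using xa(1) hk(1) by simp
      show "h \<otimes> u = inv x \<otimes> h" unfolding u_def conj_def using xa(1) hk(1) by (simp add: group_word_simps)
    qed
    have "k = k \<otimes> inv h \<otimes> h" using hk by (simp add: m_assoc)
    then have k: "k = inv a \<otimes> (inv x \<otimes> h)" unfolding kh using xa(1,2) hk(1) by (simp add: m_assoc)
    have "A #> (h \<otimes> u) = A #> k"
      unfolding u(2) k using rcos_eq_iff[OF A, of "inv x \<otimes> h" "inv a \<otimes> (inv x \<otimes> h)"] xa(1,2) hk(1)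
      by (simp add: group_word_simps)
    then have ex: "\<pi> u \<in> V" "Y <#> \<pi> u = Z" using K_quot u(1) coset_action hk by simp_all
    \<comment> \<open>If two elements have the same effect, a conjugate of their quotient lies in
      \<open>K\<close> and in \<open>A\<close>, hence in \<open>N\<close>.\<close>
    have unique: "v = w" if vw: "v \<in> V" "w \<in> V" "Y <#> v = Y <#> w" for v w
    proof -
      obtain y z where yz: "y \<in> P" "v = \<pi> y" "z \<in> P" "w = \<pi> z"
        using vw(1,2) unfolding quot_P[symmetric] by blast
      have car: "y \<in> carrier G" "z \<in> carrier G" using yz(1,3) by simp_all
      have "A #> (h \<otimes> y) = A #> (h \<otimes> z)"
        using vw(3) unfolding yz(2,4) hk(2) coset_action[OF hk(1) car(1)] coset_action[OF hk(1) car(2)] .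
      then have "(h \<otimes> y) \<otimes> inv (h \<otimes> z) \<in> A"
        using rcos_eq_iff[OF A, of "h \<otimes> y" "h \<otimes> z"] hk(1) car by simp
      then have conj_A: "conj h (y \<otimes> inv z) \<in> A"
        using hk(1) car by (simp add: conj_def group_word_simps)
      have "y \<otimes> inv z \<in> P" using yz(1,3) by simp
      then have "conj h (y \<otimes> inv z) \<in> K" using hk(1) by (intro conj_K P_in_K)
      then have "conj h (y \<otimes> inv z) \<in> N" using conj_A by (rule K_inter_A)
      then have "conj (inv h) (conj h (y \<otimes> inv z)) \<in> N" using conj_N hk(1) inv_closed by metis
      then have "y \<otimes> inv z \<in> N" using conj_conj_inv(2)[OF hk(1)] car by simp
      then show "v = w" unfolding yz(2,4) using quot_eq_iff[OF car] by simp
    qed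
    show ?thesis using ex unique by blast
  qed
  then show ?thesis
    unfolding affine_primitive_action_def using coset_primitive V_elementary Q.V by blast
qed

end

section \<open>Permutation groups\<close>

lemma rperm_group_simps [simp]:
  "carrier (rperm_group \<Omega> H) = H"
  "\<one>\<^bsub>rperm_group \<Omega> H\<^esub> = (\<lambda>x\<in>\<Omega>. x)"
  "g \<otimes>\<^bsub>rperm_group \<Omega> H\<^esub> h = compose \<Omega> h g"
  by (simp_all add: rperm_group_def)

text \<open>With the product taken in reversed order this is the opposite group of \<open>H\<close>,
  with the same inverses.\<close>

lemma group_rperm_group:
  assumes "subgroup H (BijGroup \<Omega>)"
  shows "group (rperm_group \<Omega> H)"
proof -
  interpret B: group "BijGroup \<Omega>" by (rule group_BijGroup)
  interpret H: subgroup H "BijGroup \<Omega>" by fact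
  have Bij: "x \<in> Bij \<Omega>" if "x \<in> H" for x
    using H.subset that by (auto simp: BijGroup_def)
  have mult: "compose \<Omega> y x = y \<otimes>\<^bsub>BijGroup \<Omega>\<^esub> x" if "x \<in> H" "y \<in> H" for x y
    using that Bij by (simp add: BijGroup_def)
  have one: "(\<lambda>x\<in>\<Omega>. x) = \<one>\<^bsub>BijGroup \<Omega>\<^esub>" by (simp add: BijGroup_def)
  show ?thesis
  proof (rule groupI)
    fix x y z
    assume "x \<in> carrier (rperm_group \<Omega> H)" "y \<in> carrier (rperm_group \<Omega> H)" "z \<in> carrier (rperm_group \<Omega> H)"
    then show "x \<otimes>\<^bsub>rperm_group \<Omega> H\<^esub> y \<otimes>\<^bsub>rperm_group \<Omega> H\<^esub> z =
        x \<otimes>\<^bsub>rperm_group \<Omega> H\<^esub> (y \<otimes>\<^bsub>rperm_group \<Omega> H\<^esub> z)"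
      by (simp add: mult H.m_closed B.m_assoc)
  next
    fix x assume x: "x \<in> carrier (rperm_group \<Omega> H)"
    then show "\<exists>y\<in>carrier (rperm_group \<Omega> H). y \<otimes>\<^bsub>rperm_group \<Omega> H\<^esub> x = \<one>\<^bsub>rperm_group \<Omega> H\<^esub>"
      by (intro bexI[of _ "inv\<^bsub>BijGroup \<Omega>\<^esub> x"]) (simp_all add: mult one)
  qed (simp_all add: mult one)
qed

text \<open>
  The point stabilizer is a complement of a regular subgroup, and it is not normal: a normal point
  stabilizer of a transitive permutation group fixes every point.
\<close>
lemma rperm_group_complement:
  fixes G (structure)
  assumes perm: "subgroup H (BijGroup \<Omega>)"
    and fin: "finite H"
    and G_def: "G = rperm_group \<Omega> H"
    and A_sub: "subgroup A G"
    and A_abelian: "\<forall>a\<in>A. \<forall>b\<in>A. a \<otimes> b = b \<otimes> a"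
    and A_trans: "\<forall>x\<in>\<Omega>. \<forall>y\<in>\<Omega>. \<exists>a\<in>A. a x = y"
    and A_semireg: "\<forall>x\<in>\<Omega>. \<forall>a\<in>A. a x = x \<longrightarrow> a = \<one>"
    and A_max: "maximal_subgroup G A"
    and A_selfnorm: "normalizer G A = A"
    and \<omega>: "\<omega> \<in> \<Omega>"
  defines "G1 \<equiv> {g \<in> carrier G. g \<omega> = \<omega>}"
  shows "abelian_maximal_complement G A G1"
proof -
  interpret group G unfolding G_def by (rule group_rperm_group) (rule perm)
  have carG: "carrier G = H" by (simp add: G_def)
  have apply_mult: "(x \<otimes> y) z = y (x z)" if "z \<in> \<Omega>" for x y z
    using that by (simp add: G_def compose_def)
  have apply_one: "\<one> z = z" if "z \<in> \<Omega>" for z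
    using that by (simp add: G_def)
  have bij: "x \<in> Bij \<Omega>" if "x \<in> carrier G" for x
    using subgroup.subset[OF perm] that carG by (auto simp: BijGroup_def)
  have maps: "x z \<in> \<Omega>" if "x \<in> carrier G" "z \<in> \<Omega>" for x z
    using bij[OF that(1)] that(2) by (auto simp: Bij_def bij_betw_def)
  have apply_inv: "(inv x) (x z) = z" if "x \<in> carrier G" "z \<in> \<Omega>" for x z
    using apply_mult[OF that(2), of x "inv x"] that apply_one by simp
  have G1: "subgroup G1 G"
  proof (rule subgroupI)
    show "G1 \<subseteq> carrier G" by (auto simp: G1_def)
    show "G1 \<noteq> {}" using apply_one[OF \<omega>] one_closed unfolding G1_def by blast
    show "inv x \<in> G1" if "x \<in> G1" for x
      using that apply_inv[of x \<omega>] \<omega> by (auto simp: G1_def)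
    show "x \<otimes> y \<in> G1" if "x \<in> G1" "y \<in> G1" for x y
      using that apply_mult[OF \<omega>, of x y] by (auto simp: G1_def)
  qed
  interpret A: subgroup A G by (rule A_sub)
  have A_proper: "A \<noteq> carrier G" using A_max by (simp add: maximal_subgroup_def)
  have G1_inter_A: "G1 \<inter> A = {\<one>}"
    using A_semireg \<omega> A.one_closed subgroup.one_closed[OF G1] by (auto simp: G1_def)
  have G1_mult_A: "G1 <#> A = carrier G"
  proof
    show "G1 <#> A \<subseteq> carrier G" by (rule set_mult_closed) (auto simp: G1_def)
    show "carrier G \<subseteq> G1 <#> A"
    proof
      fix g assume g: "g \<in> carrier G"
      \<comment> \<open>An \<open>a\<close> with the same effect on \<open>\<omega>\<close> as
        \<open>g\<close> places \<open>g \<otimes> inv a\<close> in the stabilizer.\<close>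
      then obtain a where a: "a \<in> A" "a \<omega> = g \<omega>" using A_trans \<omega> maps by blast
      have aG: "a \<in> carrier G" using a(1) by simp
      have "(g \<otimes> inv a) \<omega> = \<omega>"
        using apply_mult[OF \<omega>, of g "inv a"] apply_inv[OF aG \<omega>] a(2) by simp
      then have "g \<otimes> inv a \<in> G1" using g aG by (simp add: G1_def)
      moreover have "g = (g \<otimes> inv a) \<otimes> a" using g aG by (simp add: m_assoc)
      ultimately show "g \<in> G1 <#> A" using a(1) unfolding set_mult_def by blast
    qed
  qed
  have not_normal: "\<exists>g\<in>carrier G. \<exists>x\<in>G1. conj g x \<notin> G1"
  proof (rule ccontr)
    assume "\<not> ?thesis"
    then have normal: "conj g x \<in> G1" if "g \<in> carrier G" "x \<in> G1" for g x using that by blast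
    have "x = \<one>" if x: "x \<in> G1" for x
    proof
      have xG: "x \<in> carrier G" using x by (simp add: G1_def)
      fix z
      show "x z = \<one> z"
      proof (cases "z \<in> \<Omega>")
        case True
        then obtain a where a: "a \<in> A" "a \<omega> = z" using A_trans \<omega> by blast
        have aG: "a \<in> carrier G" using a(1) by simp
        have "conj a x \<omega> = \<omega>" using normal[OF aG x] by (simp add: G1_def)
        moreover have "conj a x \<omega> = (inv a) (x z)"
          unfolding conj_def using apply_mult \<omega> a(2) by simp
        ultimately have "a ((inv a) (x z)) = z" using a(2) by simp
        moreover have "(inv (inv a)) ((inv a) (x z)) = x z"
          using apply_inv[of "inv a" "x z"] aG maps[OF xG True] by simp
        ultimately show ?thesis using aG apply_one[OF True] by simp
      next
        case False
        \<comment> \<open>Outside \<Omega> all elements of the group agree, being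
          extensional.\<close>
        then show ?thesis using bij[OF xG] by (simp add: G_def Bij_def extensional_def)
      qed
    qed
    then have "G1 \<subseteq> {\<one>}" by blast
    then have G1_trivial: "G1 = {\<one>}" using subgroup.one_closed[OF G1] by blast
    \<comment> \<open>A trivial stabilizer would make \<open>A\<close> the whole group.\<close>
    have "g \<in> A" if "g \<in> carrier G" for g
    proof -
      have "g \<in> {\<one>} <#> A" using that G1_mult_A G1_trivial by simp
      then show ?thesis by (auto simp: set_mult_def)
    qed
    then have "carrier G \<subseteq> A" by (rule subsetI)
    then show False using A_proper A.subset by simp
  qed
  show  ?thesis
  proof (intro abelian_maximal_complement.intro abelian_maximal.intro
      abelian_maximal_axioms.intro abelian_maximal_complement_axioms.intro)
    show "group G" by (rule group_axioms)
    show "finite (carrier G)" using fin carG by simp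
    show "subgroup A G" by (rule A_sub)
    show "a \<otimes> b = b \<otimes> a" if "a \<in> A" "b \<in> A" for a b using A_abelian that by blast
    show "K = A \<or> K = carrier G" if "subgroup K G" "A \<subseteq> K" for K
      using A_max that unfolding maximal_subgroup_def by blast
    show "A \<noteq> carrier G" by (rule A_proper)
    show "g \<in> A" if "g \<in> carrier G" "conj g ` A = A" for g
      using that A_selfnorm mem_normalizer_iff[OF A.subset, of g] by blast
    show "subgroup G1 G" by (rule G1)
    show "G1 \<inter> A = {\<one>}" by (rule G1_inter_A)
    show "card G1 * card A = order G"
      using card_set_mult_disjoint[OF G1 A_sub G1_inter_A] G1_mult_A by (simp add: order_def)
    show "\<exists>g\<in>carrier G. \<exists>x\<in>G1. conj g x \<notin> G1" by (rule not_normal)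
  qed
qed

theorem theorem3p2:
  fixes \<Omega> :: "'a set" and H A :: "('a \<Rightarrow> 'a) set" and G and \<omega> :: 'a
  assumes perm: "subgroup H (BijGroup \<Omega>)"
    and fin: "finite H"
    and G_def: "G = rperm_group \<Omega> H"
    and A_sub: "subgroup A G"
    and A_abelian: "\<forall>a\<in>A. \<forall>b\<in>A. a \<otimes>\<^bsub>G\<^esub> b = b \<otimes>\<^bsub>G\<^esub> a"
    and A_trans: "\<forall>x\<in>\<Omega>. \<forall>y\<in>\<Omega>. \<exists>a\<in>A. a x = y"
    and A_semireg: "\<forall>x\<in>\<Omega>. \<forall>a\<in>A. a x = x \<longrightarrow> a = \<one>\<^bsub>G\<^esub>"
    and A_max: "maximal_subgroup G A"
    and A_selfnorm: "normalizer G A = A"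
    and \<omega>: "\<omega> \<in> \<Omega>"
  defines "G1 \<equiv> {g \<in> carrier G. g \<omega> = \<omega>}"
    and "Gs \<equiv> (\<lambda>s. (inv\<^bsub>G\<^esub> s <#\<^bsub>G\<^esub> {g \<in> carrier G. g \<omega> = \<omega>}) #>\<^bsub>G\<^esub> s)"
    and "N \<equiv> core G A"
  shows "\<exists>p Q S. Factorial_Ring.prime (p::nat) \<and> subgroup Q G \<and> subgroup S G \<and> Q \<noteq> {\<one>\<^bsub>G\<^esub>} \<and> S \<noteq> {\<one>\<^bsub>G\<^esub>} \<and>
     \<comment> \<open>(1)\<close>
     cyclic_group ((G\<lparr>carrier := A\<rparr>) Mod N) \<and> coprime (order ((G\<lparr>carrier := A\<rparr>) Mod N)) p \<and>
     \<comment> \<open>(2)\<close>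
     elementary_abelian_p_subgroup G p G1 \<and>
     \<comment> \<open>(3)\<close>
     inner_semidirect_product (G Mod N) ((\<lambda>x. N #>\<^bsub>G\<^esub> x) ` (G1 <#>\<^bsub>G\<^esub> N))
        ((\<lambda>x. N #>\<^bsub>G\<^esub> x) ` A) (carrier (G Mod N)) \<and>
     faithful_action (G Mod N) (rcosets\<^bsub>G\<^esub> A) (\<lambda>C Z. Z <#>\<^bsub>G\<^esub> C) \<and>
     affine_primitive_action (G Mod N) (rcosets\<^bsub>G\<^esub> A) (\<lambda>C Z. Z <#>\<^bsub>G\<^esub> C) \<and>
     \<comment> \<open>(4)\<close>
     N = center G \<and> inner_direct_product G Q (centraliser G S G1) N \<and>
     \<comment> \<open>(5)\<close>
     inner_direct_product G G1 Q (G1 <#>\<^bsub>G\<^esub> Q) \<and>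
     inner_semidirect_product G (G1 <#>\<^bsub>G\<^esub> Q) S (carrier G) \<and>
     \<comment> \<open>(6)\<close>
     inner_direct_product G Q S A \<and>
     \<comment> \<open>(7)\<close>
     sylow_subgroup G p (G1 <#>\<^bsub>G\<^esub> Q) \<and> (\<forall>P. sylow_subgroup G p P \<longrightarrow> P = G1 <#>\<^bsub>G\<^esub> Q) \<and>
     \<comment> \<open>(8)\<close>
     normalizer G G1 = centraliser G (carrier G) G1 \<and>
     inner_direct_product G G1 N (normalizer G G1) \<and>
     \<comment> \<open>(9)\<close>
     (\<forall>s\<in>carrier G - normalizer G G1. \<forall>s'\<in>carrier G - normalizer G G1.
        G1 <#>\<^bsub>G\<^esub> Gs s = G1 <#>\<^bsub>G\<^esub> Gs s')"
proof -
  interpret M: abelian_maximal_complement G A G1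
    unfolding G1_def
    by (rule rperm_group_complement[OF perm fin G_def A_sub A_abelian A_trans A_semireg A_max
          A_selfnorm \<omega>])
  have N: "N = M.N" unfolding N_def by (rule M.core_eq_N)
  \<comment> \<open>The conjugate in the theorem has \<open>inv s\<close> on the left, so it is
    \<open>M.conj\<close> for the inverse of \<open>s\<close>; the normalizer is closed under
    inverses, so (9) can be checked on inverses.\<close>
  have Gs: "Gs s = M.conj (inv\<^bsub>G\<^esub> s) ` G1" if "s \<in> carrier G" for s
    using M.conj_set_eq[OF M.inv_closed[OF that] M.P.subset]
    unfolding M.inv_inv[OF that] Gs_def G1_def .
  have T: "G1 <#>\<^bsub>G\<^esub> M.A\<^sub>p = M.T" by (simp add: M.T_def)
  have conjugates: "G1 <#>\<^bsub>G\<^esub> Gs s = G1 <#>\<^bsub>G\<^esub> Gs s'"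
    if s: "s \<in> carrier G - normalizer G G1" "s' \<in> carrier G - normalizer G G1" for s s'
  proof -
    have "s \<in> carrier G" "inv\<^bsub>G\<^esub> s \<notin> M.K" "s' \<in> carrier G" "inv\<^bsub>G\<^esub> s' \<notin> M.K"
      using s M.K.m_inv_closed[of "inv\<^bsub>G\<^esub> s"] M.K.m_inv_closed[of "inv\<^bsub>G\<^esub> s'"]
      by (auto simp: M.normalizer_P)
    then show ?thesis using M.set_mult_conj_eq[of "inv\<^bsub>G\<^esub> s" "inv\<^bsub>G\<^esub> s'"] by (simp add: Gs)
  qed
  show ?thesis
  proof (intro exI conjI)
    show "Factorial_Ring.prime M.p" by (rule M.p)
    show "subgroup M.A\<^sub>p G" "subgroup M.A\<^sub>r G" by (rule M.A\<^sub>p M.A\<^sub>r)+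
    show "M.A\<^sub>p \<noteq> {\<one>\<^bsub>G\<^esub>}" "M.A\<^sub>r \<noteq> {\<one>\<^bsub>G\<^esub>}" by (rule M.A\<^sub>p_nontrivial M.A\<^sub>r_nontrivial)+
    show "cyclic_group ((G\<lparr>carrier := A\<rparr>) Mod N)"
      "coprime (order ((G\<lparr>carrier := A\<rparr>) Mod N)) M.p"
      unfolding N by (rule M.cyclic_A_mod_N M.coprime_order_A_mod_N)+
    show "elementary_abelian_p_subgroup G M.p G1" by (rule M.P_elementary)
    show "inner_semidirect_product (G Mod N) ((\<lambda>x. N #>\<^bsub>G\<^esub> x) ` (G1 <#>\<^bsub>G\<^esub> N)) ((\<lambda>x. N #>\<^bsub>G\<^esub> x) ` A)
        (carrier (G Mod N))"
      unfolding N by (rule M.quot_semidirect)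
    show "faithful_action (G Mod N) (rcosets\<^bsub>G\<^esub> A) (\<lambda>C Z. Z <#>\<^bsub>G\<^esub> C)"
      "affine_primitive_action (G Mod N) (rcosets\<^bsub>G\<^esub> A) (\<lambda>C Z. Z <#>\<^bsub>G\<^esub> C)"
      unfolding N by (rule M.coset_faithful M.coset_affine)+
    show "N = center G" unfolding N by (rule M.N_def)
    show "inner_direct_product G M.A\<^sub>p (centraliser G M.A\<^sub>r G1) N"
      unfolding N by (rule M.N_decomposition)
    show "inner_direct_product G G1 M.A\<^sub>p (G1 <#>\<^bsub>G\<^esub> M.A\<^sub>p)"
      unfolding T by (rule M.T_direct)
    show "inner_semidirect_product G (G1 <#>\<^bsub>G\<^esub> M.A\<^sub>p) M.A\<^sub>r (carrier G)"
      unfolding T by (rule M.G_semidirect)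
    show "inner_direct_product G M.A\<^sub>p M.A\<^sub>r A" by (rule M.A_decomposition)
    show "sylow_subgroup G M.p (G1 <#>\<^bsub>G\<^esub> M.A\<^sub>p)" unfolding T by (rule M.sylow_T)
    show "\<forall>R. sylow_subgroup G M.p R \<longrightarrow> R = G1 <#>\<^bsub>G\<^esub> M.A\<^sub>p"
      unfolding T using M.sylow_unique by blast
    show "normalizer G G1 = centraliser G (carrier G) G1"
      unfolding M.normalizer_P M.centraliser_P ..
    show "inner_direct_product G G1 N (normalizer G G1)"
      unfolding N M.normalizer_P by (rule M.direct_product_K)
    show "\<forall>s\<in>carrier G - normalizer G G1. \<forall>s'\<in>carrier G - normalizer G G1.
        G1 <#>\<^bsub>G\<^esub> Gs s = G1 <#>\<^bsub>G\<^esub> Gs s'"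
      using conjugates by blast
  qed
qed

end
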